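(* Let $A$ be a $\mathbb{Q}$-domain, $K=\operatorname{frac}(A)$, $B=A^{[3]}$ and $D\in\operatorname{LND}_A(B)$. Let $(X,Y,Z)$ be a coordinate system of $B$ over $A$ such that $D(X)=0$. Assume that $\operatorname{rank} D=\operatorname{rank} D_K=2$, where $D_K$ is the extension of $D$ to $K^{[3]}$. Then $D$ is triangulable over $A$ if and only if $D$ is triangulable over $A[X]$.
   Context: $A^{[n]}$ denotes the polynomial ring in $n$ variables over $A$. A coordinate system of $B=A^{[n]}$ over $A$ is an $n$-tuple $(X_1,\dots,X_n)$ with $A[X_1,\dots,X_n]=B$. $\operatorname{LND}_A(B)$ is the set of locally nilpotent $A$-derivations of $B$. The rank of $D$ is the least $r\ge0$ such that some coordinate system $(X_1,\dots,X_n)$ of $B$ over $A$ has $A[X_1,\dots,X_{n-r}]\subset\ker D$ (similarly over $K$ for $D_K$). For a subring $R\supseteq A$ with $B=R^{[m]}$, $D$ is triangulable over $R$ if there is a coordinate system $(Y_1,\dots,Y_m)$ of $B$ over $R$ with $D(Y_i)\in R[Y_1,\dots,Y_{i-1}]$ for all $i$; here $B=A[X]^{[2]}$ since $B=A[X][Y,Z]$. *)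

theory Defs
  imports "HOL-Computational_Algebra.Polynomial" "HOL-Computational_Algebra.Fraction_Field"
begin

text \<open>The polynomial ring A^[3] = A[X1][X2][X3] is modelled as the nested polynomial
type 'a poly poly poly.  The innermost variable is X1, the outermost X3.\<close>

definition C3 :: "'a::comm_ring_1 \<Rightarrow> 'a poly poly poly" where
  "C3 c = [:[:[:c:]:]:]"

text \<open>Evaluation of a polynomial in three variables (over A) at three elements of B;
 this is the A-algebra homomorphism A[T1,T2,T3] \<rightarrow> B, T1 \<mapsto> u, T2 \<mapsto> v, T3 \<mapsto> w.
 Its image is the A-subalgebra A[u,v,w] of B.\<close>
definition eval3 :: "'a::comm_ring_1 poly poly poly \<Rightarrow> 'a poly poly poly \<Rightarrow>
    'a poly poly poly \<Rightarrow> 'a poly poly poly \<Rightarrow> 'a poly poly poly" where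
  "eval3 f u v w =
     poly (map_poly (\<lambda>g. poly (map_poly (\<lambda>h. poly (map_poly C3 h) u) g) v) f) w"

definition coord3 :: "'a::comm_ring_1 poly poly poly \<Rightarrow> 'a poly poly poly \<Rightarrow> 'a poly poly poly \<Rightarrow> bool" where
  "coord3 u v w \<longleftrightarrow> range (\<lambda>f. eval3 f u v w) = UNIV"

definition is_derivation :: "('a::comm_ring_1 poly poly poly \<Rightarrow> 'a poly poly poly) \<Rightarrow> bool" where
  "is_derivation D \<longleftrightarrow>
     (\<forall>f g. D (f + g) = D f + D g) \<and>
     (\<forall>f g. D (f * g) = f * D g + g * D f) \<and>
     (\<forall>a. D (C3 a) = 0)"

definition is_LND :: "('a::comm_ring_1 poly poly poly \<Rightarrow> 'a poly poly poly) \<Rightarrow> bool" where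
  "is_LND D \<longleftrightarrow> is_derivation D \<and> (\<forall>f. \<exists>n. (D ^^ n) f = 0)"

text \<open>Rank: least r such that some coordinate system (X1,X2,X3) has
  A[X1,...,X_{3-r}] contained in ker D.  The subalgebra A[X1,...,X_{3-r}] is
  the image of eval3 at the first 3-r coordinates padded with zeros.\<close>
definition rank3 :: "('a::comm_ring_1 poly poly poly \<Rightarrow> 'a poly poly poly) \<Rightarrow> nat" where
  "rank3 D = (LEAST r. \<exists>u v w. coord3 u v w \<and>
      (let gs = take (3 - r) [u, v, w] @ replicate r 0 in
        \<forall>f. D (eval3 f (gs ! 0) (gs ! 1) (gs ! 2)) = 0))"

definition embK :: "'a::idom poly poly poly \<Rightarrow> 'a fract poly poly poly" where
  "embK = map_poly (map_poly (map_poly (\<lambda>a. Fract a 1)))"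

definition extK :: "('a::idom poly poly poly \<Rightarrow> 'a poly poly poly) \<Rightarrow>
    ('a fract poly poly poly \<Rightarrow> 'a fract poly poly poly)" where
  "extK D = (THE DK. is_derivation DK \<and> (\<forall>f. DK (embK f) = embK (D f)))"

definition triangulable_A :: "('a::comm_ring_1 poly poly poly \<Rightarrow> 'a poly poly poly) \<Rightarrow> bool" where
  "triangulable_A D \<longleftrightarrow> (\<exists>y1 y2 y3. coord3 y1 y2 y3 \<and>
      (\<exists>a. D y1 = C3 a) \<and>
      (\<exists>f. D y2 = eval3 f y1 0 0) \<and>
      (\<exists>f. D y3 = eval3 f y1 y2 0))"

text \<open>Triangulable over R = A[x], where B = R^[2]: a coordinate system (y1,y2) of B over
  A[x] (i.e. A[x][y1,y2] = A[x,y1,y2] = B) with D y1 \<in> A[x] and D y2 \<in> A[x][y1].\<close>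
definition triangulable_over_var :: "('a::comm_ring_1 poly poly poly \<Rightarrow> 'a poly poly poly) \<Rightarrow>
    'a poly poly poly \<Rightarrow> bool" where
  "triangulable_over_var D x \<longleftrightarrow> (\<exists>y1 y2. range (\<lambda>f. eval3 f x y1 y2) = UNIV \<and>
      (\<exists>f. D y1 = eval3 f x 0 0) \<and>
      (\<exists>f. D y2 = eval3 f x y1 0))"

definition Q_domain :: "'a::idom itself \<Rightarrow> bool" where
  "Q_domain _ \<longleftrightarrow> (\<forall>n::nat. n \<noteq> 0 \<longrightarrow> (\<exists>b::'a. of_nat n * b = 1))"

end

theory Submission
  imports "HOL-Algebra.Algebraic_Closure_Type" Defs
begin

text \<open>
  Let \<open>(y\<^sub>1, y\<^sub>2, y\<^sub>3)\<close> triangulate \<open>D\<close> over \<open>A\<close>. Since \<open>D\<^sub>K\<close> has rank 2 it has no slice among the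
  coordinates, so \<open>D y\<^sub>1 = 0\<close> and \<open>D = f(x) \<partial>\<^sub>y + g(x,y) \<partial>\<^sub>z\<close> in these coordinates; everything reduces to
  \<open>A[X] = A[y\<^sub>1]\<close>. By degrees it is enough that \<open>X \<in> k[x]\<close> over the algebraic closure \<open>k\<close> of \<open>K\<close>.
  Remove the common factor of \<open>f\<close> and \<open>g\<close>; then the kernel is \<open>k[x, P]\<close> with \<open>P = f z - \<integral> g dy\<close>.

  Suppose that the variable \<open>X\<close> of the kernel is not in \<open>k[x]\<close>. Relative to \<open>k[X]\<close> the derivation is a
  Jacobian derivation in two variables, and \<open>B / D B\<close>, which is \<open>f\<close>-power torsion, carries the inverse of
  a Gauss-Manin connection, an injective map lowering the torsion order at \<open>x = \<lambda>\<close> up to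
  \<open>k[X]\<close>-torsion. Hence \<open>(x - \<lambda>) h \<in> D B\<close> implies \<open>c(X) h \<in> D B\<close> for some \<open>c \<noteq> 0\<close>. Applied to an element
  \<open>e(x) \<in> D B\<close> of least degree this shows that \<open>e\<close> is constant, so \<open>D\<close> has a slice \<open>s\<close> and
  \<open>(x, P, s)\<close> is a coordinate system with \<open>x, P\<close> in the kernel. It descends to \<open>K\<close>, and \<open>D\<^sub>K\<close> would have
  rank at most 1.
\<close>

no_notation Polynomials.var (\<open>X\<index>\<close>)

section \<open>Homomorphisms and derivations of the polynomial ring\<close>

definition is_hom :: "('a::comm_ring_1 \<Rightarrow> 'b::comm_ring_1) \<Rightarrow> bool" where
  "is_hom h \<longleftrightarrow> (\<forall>a b. h (a + b) = h a + h b) \<and> (\<forall>a b. h (a * b) = h a * h b) \<and> h 1 = 1"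

lemma hom_add: "is_hom h \<Longrightarrow> h (a + b) = h a + h b"
  and hom_mult: "is_hom h \<Longrightarrow> h (a * b) = h a * h b"
  and hom_1: "is_hom h \<Longrightarrow> h 1 = 1"
  by (auto simp: is_hom_def)

lemma hom_0: "is_hom h \<Longrightarrow> h 0 = 0"
  by (metis hom_add add.right_neutral add_left_cancel)

lemma hom_uminus: "is_hom h \<Longrightarrow> h (- a) = - h a"
  by (metis hom_0 hom_add add.left_inverse add_eq_0_iff2)

lemma hom_diff: "is_hom h \<Longrightarrow> h (a - b) = h a - h b"
  using hom_add[of h a "- b"] hom_uminus[of h b] by simp

lemma hom_power: "is_hom h \<Longrightarrow> h (a ^ n) = h a ^ n"
  by (induction n) (simp_all add: hom_1 hom_mult)

lemma hom_of_nat: "is_hom h \<Longrightarrow> h (of_nat n) = of_nat n"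
  by (induction n) (simp_all add: hom_0 hom_1 hom_add)

lemmas hom_simps = hom_0 hom_1 hom_add hom_mult hom_uminus hom_diff hom_power hom_of_nat

lemma is_hom_id: "is_hom (\<lambda>x. x)"
  by (simp add: is_hom_def)

lemma is_hom_comp: "is_hom g \<Longrightarrow> is_hom h \<Longrightarrow> is_hom (\<lambda>x. g (h x))"
  by (simp add: is_hom_def)

lemma is_hom_const: "is_hom (\<lambda>c. [:c:])"
  by (simp add: is_hom_def one_pCons)

lemma map_poly_add': "(\<And>a b. h (a + b) = h a + h b) \<Longrightarrow> map_poly h (p + q) = map_poly h p + map_poly h q"
  for h :: "'a::comm_ring_1 \<Rightarrow> 'b::comm_ring_1"
proof -
  assume h: "\<And>a b. h (a + b) = h a + h b"
  have "h 0 = 0" using h[of 0 0] by simp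
  then show "map_poly h (p + q) = map_poly h p + map_poly h q"
    by (intro poly_eqI) (simp add: coeff_map_poly h)
qed

lemma is_hom_map_poly:
  assumes h: "is_hom h"
  shows "is_hom (map_poly h)"
proof -
  note s = hom_simps[OF h]
  have pc: "map_poly h (pCons a p) = pCons (h a) (map_poly h p)" for a p
    by (simp add: map_poly_pCons s)
  have ad: "map_poly h (p + q) = map_poly h p + map_poly h q" for p q
    by (rule map_poly_add') (rule s)
  have sm: "map_poly h (smult a q) = smult (h a) (map_poly h q)" for a q
    by (rule poly_eqI) (simp add: coeff_map_poly s)
  have "map_poly h (p * q) = map_poly h p * map_poly h q" for p q
    by (induction p) (simp_all add: pc ad sm s)
  then show ?thesis
    by (simp add: is_hom_def ad s)
qed

lemma is_hom_poly: "is_hom (\<lambda>p. poly p u)"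
  by (simp add: is_hom_def)

lemma is_hom_eval: "is_hom h \<Longrightarrow> is_hom (\<lambda>p. poly (map_poly h p) u)"
  by (rule is_hom_comp[OF is_hom_poly is_hom_map_poly])

lemma is_hom_pcompose: "is_hom (\<lambda>p. pcompose p u)"
  by (simp add: is_hom_def pcompose_add pcompose_mult pcompose_1)

lemma map_poly_hom_pCons [simp]: "is_hom h \<Longrightarrow> map_poly h (pCons a p) = pCons (h a) (map_poly h p)"
  by (simp add: map_poly_pCons hom_0[of h])

lemma pCons_conv: "pCons a p = [:a:] + [:0, 1:] * (p::'a::comm_ring_1 poly)"
  by simp

lemma hom_poly_eqI:
  assumes g: "is_hom g" and h: "is_hom h"
    and c: "\<And>c. g [:c:] = h [:c:]" and x: "g [:0, 1:] = h [:0, 1:]"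
  shows "g p = h p"
proof (induction p)
  case 0
  then show ?case by (simp add: hom_0 g h)
next
  case (pCons a p)
  then show ?case
    by (simp only: pCons_conv[of a p] hom_add[OF g] hom_add[OF h] hom_mult[OF g] hom_mult[OF h] c x)
qed

section \<open>Substitution in three variables\<close>

abbreviation X1 :: "'a::comm_ring_1 poly poly poly" where "X1 \<equiv> [:[:[:0, 1:]:]:]"
abbreviation X2 :: "'a::comm_ring_1 poly poly poly" where "X2 \<equiv> [:[:0, 1:]:]"
abbreviation X3 :: "'a::comm_ring_1 poly poly poly" where "X3 \<equiv> [:0, 1:]"

lemma hom3_eqI:
  assumes g: "is_hom g" and h: "is_hom h"
    and c: "\<And>c. g (C3 c) = h (C3 c)" and x: "g X1 = h X1" "g X2 = h X2" "g X3 = h X3"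
  shows "g p = h p"
proof (rule hom_poly_eqI[OF g h _ x(3)])
  fix c1
  note k = is_hom_comp[OF _ is_hom_const]
  note k2 = is_hom_comp[OF is_hom_comp[OF _ is_hom_const] is_hom_const]
  show "g [:c1:] = h [:c1:]"
  proof (rule hom_poly_eqI[OF k[OF g] k[OF h] _ x(2)])
    fix c2
    show "g [:[:c2:]:] = h [:[:c2:]:]"
      by (rule hom_poly_eqI[OF k2[OF g] k2[OF h] _ x(1)]) (use c in \<open>simp add: C3_def\<close>)
  qed
qed

lemma is_hom_C3: "is_hom C3"
  by (simp add: is_hom_def C3_def one_pCons)

lemma is_hom_eval3: "is_hom (\<lambda>f. eval3 f u v w)"
  unfolding eval3_def by (intro is_hom_eval is_hom_C3)

lemma eval3_C3 [simp]: "eval3 (C3 c) u v w = C3 c"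
  and eval3_X1 [simp]: "eval3 X1 u v w = u"
  and eval3_X2 [simp]: "eval3 X2 u v w = v"
  and eval3_X3 [simp]: "eval3 X3 u v w = w"
proof -
  define h1 where "h1 = (\<lambda>p. poly (map_poly C3 p) u)"
  define h2 where "h2 = (\<lambda>p. poly (map_poly h1 p) v)"
  have h1: "is_hom h1" unfolding h1_def by (intro is_hom_eval is_hom_C3)
  have h2: "is_hom h2" unfolding h2_def by (intro is_hom_eval h1)
  have ev: "eval3 f u v w = poly (map_poly h2 f) w" for f
    by (simp add: eval3_def h2_def h1_def)
  have 1: "h1 [:c:] = C3 c" "h1 [:0, 1:] = u" for c
    by (simp_all add: h1_def is_hom_C3 hom_simps[OF is_hom_C3])
  have 2: "h2 [:c:] = h1 c" "h2 [:0, 1:] = v" for c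
    by (simp_all add: h2_def h1 hom_simps[OF h1])
  show "eval3 (C3 c) u v w = C3 c" "eval3 X1 u v w = u" "eval3 X2 u v w = v" "eval3 X3 u v w = w"
    by (simp_all add: ev C3_def[of c] h2 hom_simps[OF h2] 1 2)
qed

lemmas eval3_simps = hom_simps[OF is_hom_eval3]

lemma alg_hom_eval3:
  assumes h: "is_hom h" and c: "\<And>c. h (C3 c) = C3 c"
  shows "h (eval3 f u v w) = eval3 f (h u) (h v) (h w)"
  by (rule hom3_eqI[of "\<lambda>f. h (eval3 f u v w)"]) (simp_all add: is_hom_comp[OF h is_hom_eval3] is_hom_eval3 c)

lemma eval3_eval3: "eval3 (eval3 f a b c) u v w = eval3 f (eval3 a u v w) (eval3 b u v w) (eval3 c u v w)"
  by (rule alg_hom_eval3[OF is_hom_eval3]) simp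

lemma eval3_self [simp]: "eval3 f X1 X2 X3 = f"
  by (rule hom3_eqI[of "\<lambda>f. eval3 f X1 X2 X3" "\<lambda>f. f"]) (simp_all add: is_hom_eval3 is_hom_id)

lemma coord3I:
  assumes "eval3 a u v w = X1" "eval3 b u v w = X2" "eval3 c u v w = X3"
  shows "coord3 u v w"
proof -
  have "eval3 (eval3 f a b c) u v w = f" for f
    by (simp add: eval3_eval3 assms)
  then show ?thesis unfolding coord3_def by (rule surjI)
qed

definition map3 :: "('a::comm_ring_1 \<Rightarrow> 'b::comm_ring_1) \<Rightarrow> 'a poly poly poly \<Rightarrow> 'b poly poly poly" where
  "map3 h = map_poly (map_poly (map_poly h))"

lemma is_hom_map3: "is_hom h \<Longrightarrow> is_hom (map3 h)"
  unfolding map3_def by (intro is_hom_map_poly)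

lemma map3_basic [simp]:
  assumes "is_hom h"
  shows "map3 h (C3 c) = C3 (h c)" "map3 h X1 = X1" "map3 h X2 = X2" "map3 h X3 = X3"
  using assms by (simp_all add: map3_def C3_def is_hom_map_poly hom_0[OF assms] hom_1[OF assms])

lemma map3_eval3:
  assumes h: "is_hom h"
  shows "map3 h (eval3 f u v w) = eval3 (map3 h f) (map3 h u) (map3 h v) (map3 h w)"
proof (rule hom3_eqI[of "\<lambda>f. map3 h (eval3 f u v w)"
      "\<lambda>f. eval3 (map3 h f) (map3 h u) (map3 h v) (map3 h w)"])
  show "is_hom (\<lambda>f. map3 h (eval3 f u v w))"
    by (rule is_hom_comp[OF is_hom_map3[OF h] is_hom_eval3])
  show "is_hom (\<lambda>f. eval3 (map3 h f) (map3 h u) (map3 h v) (map3 h w))"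
    by (rule is_hom_comp[OF is_hom_eval3 is_hom_map3[OF h]])
qed (simp_all add: h)

lemma coord3_ex: "coord3 u v w \<Longrightarrow> \<exists>a. eval3 a u v w = b"
proof -
  assume "coord3 u v w"
  then have "b \<in> range (\<lambda>f. eval3 f u v w)" by (simp add: coord3_def)
  then show ?thesis by auto
qed

lemma coord3_map3:
  assumes h: "is_hom h" and "coord3 u v w"
  shows "coord3 (map3 h u) (map3 h v) (map3 h w)"
proof -
  obtain a b c where "eval3 a u v w = X1" "eval3 b u v w = X2" "eval3 c u v w = X3"
    using coord3_ex[OF assms(2)] by meson
  then show ?thesis
    by (intro coord3I[of "map3 h a" _ _ _ "map3 h b" "map3 h c"]) (simp_all add: map3_eval3[OF h, symmetric] h)
qed

section \<open>Derivations along a homomorphism, partial derivatives\<close>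

definition hder :: "('a::comm_ring_1 \<Rightarrow> 'b::comm_ring_1) \<Rightarrow> ('a \<Rightarrow> 'b) \<Rightarrow> bool" where
  "hder h d \<longleftrightarrow> (\<forall>a b. d (a + b) = d a + d b) \<and> (\<forall>a b. d (a * b) = h a * d b + h b * d a)"

abbreviation der :: "('a::comm_ring_1 \<Rightarrow> 'a) \<Rightarrow> bool" where
  "der d \<equiv> hder (\<lambda>x. x) d"

lemma hder_add: "hder h d \<Longrightarrow> d (a + b) = d a + d b"
  and hder_mult: "hder h d \<Longrightarrow> d (a * b) = h a * d b + h b * d a"
  by (auto simp: hder_def)

lemma hder_0: "hder h d \<Longrightarrow> d 0 = 0"
  by (metis hder_add add.right_neutral add_left_cancel)

lemma hder_uminus: "hder h d \<Longrightarrow> d (- a) = - d a"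
  by (metis hder_0 hder_add add.left_inverse add_eq_0_iff2)

lemma hder_diff: "hder h d \<Longrightarrow> d (a - b) = d a - d b"
  using hder_add[of h d a "- b"] hder_uminus[of h d b] by simp

lemma hder_1: "hder h d \<Longrightarrow> is_hom h \<Longrightarrow> d 1 = 0"
  using hder_mult[of h d 1 1] by (simp add: hom_1)

lemma hder_poly_eqI:
  assumes g: "hder h d" and h: "hder h d'"
    and c: "\<And>c. d [:c:] = d' [:c:]" and x: "d [:0, 1:] = d' [:0, 1:]"
  shows "d p = d' p"
proof (induction p)
  case 0
  then show ?case by (simp add: hder_0[OF g] hder_0[OF h])
next
  case (pCons a p)
  then show ?case
    by (simp only: pCons_conv[of a p] hder_add[OF g] hder_add[OF h] hder_mult[OF g] hder_mult[OF h] c x)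
qed

lemma hder_comp_hom: "hder h d \<Longrightarrow> is_hom g \<Longrightarrow> hder (\<lambda>x. h (g x)) (\<lambda>x. d (g x))"
  by (simp add: hder_def is_hom_def)

lemma hder3_eqI:
  assumes g: "hder h d" and h: "hder h d'"
    and c: "\<And>c. d (C3 c) = d' (C3 c)" and x: "d X1 = d' X1" "d X2 = d' X2" "d X3 = d' X3"
  shows "d p = d' p"
proof (rule hder_poly_eqI[OF g h _ x(3)])
  fix c1
  note k = hder_comp_hom[OF _ is_hom_const]
  note k2 = hder_comp_hom[OF hder_comp_hom[OF _ is_hom_const] is_hom_const]
  show "d [:c1:] = d' [:c1:]"
  proof (rule hder_poly_eqI[OF k[OF g] k[OF h] _ x(2)])
    fix c2
    show "d [:[:c2:]:] = d' [:[:c2:]:]"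
      by (rule hder_poly_eqI[OF k2[OF g] k2[OF h] _ x(1)]) (use c in \<open>simp add: C3_def\<close>)
  qed
qed

lemma is_derivation_iff: "is_derivation D \<longleftrightarrow> der D \<and> (\<forall>a. D (C3 a) = 0)"
  by (simp add: is_derivation_def hder_def)

lemma der_pderiv: "der (pderiv :: 'a::idom poly \<Rightarrow> _)"
  by (simp add: hder_def pderiv_add pderiv_mult)

lemma der_map_poly:
  assumes d: "der d"
  shows "der (map_poly d)"
proof -
  have d0: "d 0 = 0" by (rule hder_0[OF d])
  have pc: "map_poly d (pCons a p) = pCons (d a) (map_poly d p)" for a p
    by (simp add: map_poly_pCons d0)
  have ad: "map_poly d (p + q) = map_poly d p + map_poly d q" for p q
    by (rule map_poly_add') (rule hder_add[OF d])
  have sm: "map_poly d (smult a q) = smult a (map_poly d q) + smult (d a) q" for a q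
    by (rule poly_eqI) (simp add: coeff_map_poly d0 hder_mult[OF d])
  have "map_poly d (p * q) = p * map_poly d q + q * map_poly d p" for p q
    by (induction p) (simp_all add: pc ad sm d0 algebra_simps)
  then show ?thesis
    by (simp add: hder_def ad)
qed

definition dd1 :: "'a::idom poly poly poly \<Rightarrow> 'a poly poly poly" where "dd1 = map_poly (map_poly pderiv)"
definition dd2 :: "'a::idom poly poly poly \<Rightarrow> 'a poly poly poly" where "dd2 = map_poly pderiv"
definition dd3 :: "'a::idom poly poly poly \<Rightarrow> 'a poly poly poly" where "dd3 = pderiv"

lemma der_dd: "der dd1" "der dd2" "der dd3"
  unfolding dd1_def dd2_def dd3_def by (intro der_map_poly der_pderiv)+

lemma dd_basic [simp]:
  "dd1 (C3 c) = 0" "dd2 (C3 c) = 0" "dd3 (C3 c) = 0"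
  "dd1 X1 = 1" "dd2 X1 = 0" "dd3 X1 = 0"
  "dd1 X2 = 0" "dd2 X2 = 1" "dd3 X2 = 0"
  "dd1 X3 = 0" "dd2 X3 = 0" "dd3 X3 = 1"
  by (simp_all add: dd1_def dd2_def dd3_def C3_def map_poly_pCons pderiv_pCons one_pCons)

lemma hder_lin3:
  assumes "is_hom h" "der d1" "der d2" "der d3"
  shows "hder h (\<lambda>f. h (d1 f) * a + h (d2 f) * b + h (d3 f) * c)"
  unfolding hder_def by (auto simp: hom_simps[OF assms(1)] hder_add[OF assms(2)] hder_add[OF assms(3)] hder_add[OF assms(4)]
      hder_mult[OF assms(2)] hder_mult[OF assms(3)] hder_mult[OF assms(4)] algebra_simps)

text \<open>The chain rule. Both sides are derivations along the substitution, so comparing them on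
  constants and variables suffices; this is why \<open>hder\<close> allows a general
  \<open>h\<close>.\<close>

lemma derivation_eval3:
  assumes D: "is_derivation D"
  shows "D (eval3 f u v w) = eval3 (dd1 f) u v w * D u + eval3 (dd2 f) u v w * D v + eval3 (dd3 f) u v w * D w"
proof (rule hder3_eqI[where h = "\<lambda>f. eval3 f u v w" and d = "\<lambda>f. D (eval3 f u v w)"
      and d' = "\<lambda>p. eval3 (dd1 p) u v w * D u + eval3 (dd2 p) u v w * D v + eval3 (dd3 p) u v w * D w"])
  show "hder (\<lambda>f. eval3 f u v w) (\<lambda>f. D (eval3 f u v w))"
    by (rule hder_comp_hom[where h = "\<lambda>x. x"]) (use D in \<open>simp_all add: is_derivation_iff is_hom_eval3\<close>)
  show "hder (\<lambda>f. eval3 f u v w) (\<lambda>p. eval3 (dd1 p) u v w * D u + eval3 (dd2 p) u v w * D v + eval3 (dd3 p) u v w * D w)"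
    by (intro hder_lin3 is_hom_eval3 der_dd)
qed (use D in \<open>simp_all add: is_derivation_iff eval3_simps\<close>)

lemma derivation_formula:
  assumes D: "is_derivation D"
  shows "D f = dd1 f * D X1 + dd2 f * D X2 + dd3 f * D X3"
  using derivation_eval3[OF D, of f X1 X2 X3] by simp

lemma is_derivation_lin3: "is_derivation (\<lambda>f. dd1 f * a + dd2 f * b + dd3 f * c)"
  using hder_lin3[OF is_hom_id der_dd] by (simp add: is_derivation_iff)

lemma is_derivation_dd: "is_derivation dd1" "is_derivation dd2" "is_derivation dd3"
  by (simp_all add: is_derivation_iff der_dd)

section \<open>Injectivity of coordinate systems in characteristic 0\<close>

lemma pderiv_eq_0_char0:
  assumes "CHAR('a::idom) = 0" "pderiv (p::'a poly) = 0"
  shows "degree p = 0"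
proof (rule ccontr)
  assume n: "degree p \<noteq> 0"
  then obtain m where m: "degree p = Suc m" by (cases "degree p") auto
  have "coeff (pderiv p) m = of_nat (Suc m) * coeff p (Suc m)" by (rule coeff_pderiv)
  then have "of_nat (Suc m) * lead_coeff p = 0" using assms(2) m by simp
  moreover have "(of_nat (Suc m)::'a) \<noteq> 0"
    using assms(1) of_nat_eq_0_iff_char_dvd[of "Suc m", where 'a = 'a] by (metis dvd_0_left_iff nat.distinct(1))
  ultimately show False using m by (metis leading_coeff_0_iff mult_eq_0_iff degree_0 nat.distinct(1))
qed

lemma degree_pderiv_less: "degree (p::'a::idom poly) \<noteq> 0 \<Longrightarrow> degree (pderiv p) < degree p"
proof -
  assume "degree p \<noteq> 0"
  moreover have "degree (pderiv p) \<le> degree p - 1"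
    by (rule degree_le) (auto simp: coeff_pderiv coeff_eq_0)
  ultimately show ?thesis by linarith
qed

text \<open>Differentiation makes a nonconstant polynomial smaller in degree but keeps it nonzero,
  so iterating it inside \<open>S\<close> ends at a nonzero constant.\<close>

lemma pderiv_closed_const:
  assumes ch: "CHAR('a::idom) = 0"
    and "p \<in> S" "p \<noteq> 0" and cl: "\<And>q. q \<in> S \<Longrightarrow> pderiv q \<in> S"
  shows "\<exists>c::'a. c \<noteq> 0 \<and> [:c:] \<in> S"
  using assms(2,3)
proof (induction "degree p" arbitrary: p rule: less_induct)
  case less
  show ?case
  proof (cases "degree p = 0")
    case True
    then obtain c where "p = [:c:]" by (metis degree_eq_zeroE)
    then show ?thesis using less by auto
  next
    case False
    then show ?thesis
      using less(1)[of "pderiv p"] less(2) cl[of p] degree_pderiv_less[of p] pderiv_eq_0_char0[OF ch, of p] by auto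
  qed
qed

text \<open>Determinants multiply, so \<open>db\<close> is nonzero; combining the relations for
  \<open>v\<close> with the cofactors of the right factor gives \<open>v1 * db = 0\<close> and
  likewise for the other entries.\<close>

lemma matrix3_cancel:
  fixes a11 :: "'a::idom"
  assumes
    "a11*b11 + a12*b21 + a13*b31 = 1" "a11*b12 + a12*b22 + a13*b32 = 0" "a11*b13 + a12*b23 + a13*b33 = 0"
    "a21*b11 + a22*b21 + a23*b31 = 0" "a21*b12 + a22*b22 + a23*b32 = 1" "a21*b13 + a22*b23 + a23*b33 = 0"
    "a31*b11 + a32*b21 + a33*b31 = 0" "a31*b12 + a32*b22 + a33*b32 = 0" "a31*b13 + a32*b23 + a33*b33 = 1"
    and v: "v1*b11 + v2*b21 + v3*b31 = 0" "v1*b12 + v2*b22 + v3*b32 = 0" "v1*b13 + v2*b23 + v3*b33 = 0"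
  shows "v1 = 0 \<and> v2 = 0 \<and> v3 = 0"
proof -
  define da where "da = a11*(a22*a33 - a23*a32) - a12*(a21*a33 - a23*a31) + a13*(a21*a32 - a22*a31)"
  define db where "db = b11*(b22*b33 - b23*b32) - b12*(b21*b33 - b23*b31) + b13*(b21*b32 - b22*b31)"
  define c where "c = (\<lambda>(p1,p2,p3) (q1,q2,q3) (r1,r2,r3::'a). p1*(q2*r3 - q3*r2) - p2*(q1*r3 - q3*r1) + p3*(q1*r2 - q2*r1))"
  have "da * db = c (a11*b11 + a12*b21 + a13*b31, a11*b12 + a12*b22 + a13*b32, a11*b13 + a12*b23 + a13*b33)
     (a21*b11 + a22*b21 + a23*b31, a21*b12 + a22*b22 + a23*b32, a21*b13 + a22*b23 + a23*b33)
     (a31*b11 + a32*b21 + a33*b31, a31*b12 + a32*b22 + a33*b32, a31*b13 + a32*b23 + a33*b33)"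
    unfolding da_def db_def c_def prod.case by (simp add: algebra_simps)
  also have "\<dots> = 1" unfolding assms c_def by simp
  finally have "db \<noteq> 0" by auto
  moreover have "v1 * db = (v1*b11 + v2*b21 + v3*b31) * (b22*b33 - b23*b32) + (v1*b12 + v2*b22 + v3*b32) * (b23*b31 - b21*b33) + (v1*b13 + v2*b23 + v3*b33) * (b21*b32 - b22*b31)"
    unfolding db_def by (simp add: algebra_simps)
  then have "v1 * db = 0" using v by simp
  moreover have "v2 * db = (v1*b11 + v2*b21 + v3*b31) * (b13*b32 - b12*b33) + (v1*b12 + v2*b22 + v3*b32) * (b11*b33 - b13*b31) + (v1*b13 + v2*b23 + v3*b33) * (b12*b31 - b11*b32)"
    unfolding db_def by (simp add: algebra_simps)
  then have "v2 * db = 0" using v by simp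
  moreover have "v3 * db = (v1*b11 + v2*b21 + v3*b31) * (b12*b23 - b13*b22) + (v1*b12 + v2*b22 + v3*b32) * (b13*b21 - b11*b23) + (v1*b13 + v2*b23 + v3*b33) * (b11*b22 - b12*b21)"
    unfolding db_def by (simp add: algebra_simps)
  then have "v3 * db = 0" using v by simp
  ultimately show ?thesis by auto
qed

text \<open>If \<open>x\<^sub>i = \<Phi>(a\<^sub>i)\<close>, the chain rule makes the Jacobian matrix of \<open>\<Phi>\<close> invertible;
  hence the kernel of \<open>\<Phi>\<close> is stable under the partial derivatives and
  would contain a nonzero constant if it were nonzero.\<close>
lemma coord3_inj:
  fixes u v w :: "'a::idom poly poly poly"
  assumes ch: "CHAR('a) = 0" and co: "coord3 u v w"
  shows "inj (\<lambda>f. eval3 f u v w)"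
proof -
  let ?E = "\<lambda>f. eval3 f u v w"
  obtain a b c where abc: "?E a = X1" "?E b = X2" "?E c = X3"
    using coord3_ex[OF co] by meson
  have ch: "d (?E f) = ?E (dd1 f) * d u + ?E (dd2 f) * d v + ?E (dd3 f) * d w"
    if "d \<in> {dd1, dd2, dd3}" for f d
    using that by (auto intro!: derivation_eval3 is_derivation_dd)
  define S where "S = {f. ?E f = 0}"
  have cl: "?E (dd1 f) = 0 \<and> ?E (dd2 f) = 0 \<and> ?E (dd3 f) = 0" if "?E f = 0" for f
  proof -
    have dd0: "dd1 0 = (0::'a poly poly poly)" "dd2 0 = (0::'a poly poly poly)" "dd3 0 = (0::'a poly poly poly)"
      using hder_0 der_dd by blast+
    show ?thesis
      by (rule matrix3_cancel[of "?E (dd1 a)" "dd1 u" "?E (dd2 a)" "dd1 v" "?E (dd3 a)" "dd1 w"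
            "dd2 u" "dd2 v" "dd2 w" "dd3 u" "dd3 v" "dd3 w"
            "?E (dd1 b)" "?E (dd2 b)" "?E (dd3 b)" "?E (dd1 c)" "?E (dd2 c)" "?E (dd3 c)"])
        (simp_all add: ch[symmetric] abc that dd0)
  qed
  have z: "f = 0" if f: "?E f = 0" for f
  proof (rule ccontr)
    assume "f \<noteq> 0"
    then have "\<exists>c. c \<noteq> 0 \<and> [:c:] \<in> S"
      using f cl assms(1) by (intro pderiv_closed_const[of f]) (auto simp: S_def dd3_def)
    then obtain c1 where c1: "c1 \<noteq> 0" "[:c1:] \<in> S" by blast
    \<comment> \<open>The kernel elements free of the outer variables are again stable under
      differentiation, so the argument repeats for the middle and the innermost variable.\<close>
    have "\<exists>c. c \<noteq> 0 \<and> [:c:] \<in> {c. [:c:] \<in> S}"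
    proof (rule pderiv_closed_const[of c1])
      fix q assume "q \<in> {c. [:c:] \<in> S}"
      then show "pderiv q \<in> {c. [:c:] \<in> S}"
        using cl[of "[:q:]"] by (simp add: S_def dd2_def map_poly_pCons)
    qed (use c1 assms(1) in auto)
    then obtain c2 where c2: "c2 \<noteq> 0" "[:[:c2:]:] \<in> S" by blast
    have "\<exists>c. c \<noteq> 0 \<and> [:c:] \<in> {c. [:[:c:]:] \<in> S}"
    proof (rule pderiv_closed_const[of c2])
      fix q assume "q \<in> {c. [:[:c:]:] \<in> S}"
      then show "pderiv q \<in> {c. [:[:c:]:] \<in> S}"
        using cl[of "[:[:q:]:]"] by (simp add: S_def dd1_def map_poly_pCons)
    qed (use c2 assms(1) in auto)
    then obtain c3 where "c3 \<noteq> 0" "[:[:[:c3:]:]:] \<in> S" by blast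
    then show False
      using eval3_C3[of c3 u v w] by (simp add: S_def C3_def)
  qed
  show ?thesis
  proof (rule injI)
    fix f g assume "?E f = ?E g"
    then have "?E (f - g) = 0" by (simp add: eval3_simps)
    then show "f = g" using z[of "f - g"] by simp
  qed
qed

section \<open>Reduced triangular derivations over an algebraically closed field\<close>

lemma Q_domain_char:
  assumes "Q_domain TYPE('a::idom)"
  shows "CHAR('a) = 0"
proof -
  have "(of_nat n :: 'a) \<noteq> 0" if "n > 0" for n
    using assms that unfolding Q_domain_def by (metis mult_zero_left zero_neq_one not_gr_zero)
  then show ?thesis by (simp add: CHAR_eq0_iff)
qed

lemma Q_domain_poly:
  assumes "Q_domain TYPE('a::idom)"
  shows "Q_domain TYPE('a poly)"
  unfolding Q_domain_def
proof (intro allI impI)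
  fix n :: nat assume "n \<noteq> 0"
  then obtain b :: 'a where "of_nat n * b = 1"
    using assms unfolding Q_domain_def by blast
  then have "of_nat n * [:b:] = 1" by (simp add: of_nat_poly one_pCons mult.commute)
  then show "\<exists>b::'a poly. of_nat n * b = 1" by blast
qed

lemma Q_domain_field:
  assumes "CHAR('a::field) = 0"
  shows "Q_domain TYPE('a)"
  unfolding Q_domain_def
proof (intro allI impI)
  fix n :: nat assume "n \<noteq> 0"
  then have "(of_nat n :: 'a) \<noteq> 0" using assms by (simp add: CHAR_eq0_iff)
  then have "of_nat n * inverse (of_nat n :: 'a) = 1" by simp
  then show "\<exists>b::'a. of_nat n * b = 1" by blast
qed

lemma pderiv_surj:
  assumes Q: "Q_domain TYPE('a::idom)"
  shows "\<exists>q. pderiv q = (p :: 'a poly)"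
proof -
  obtain b :: "nat \<Rightarrow> 'a" where b: "\<And>n. n \<noteq> 0 \<Longrightarrow> of_nat n * b n = 1"
    using Q unfolding Q_domain_def by metis
  have "pderiv (\<Sum>i\<le>degree p. monom (b (Suc i) * coeff p i) (Suc i)) = p"
  proof (rule poly_eqI)
    fix n
    have "coeff (\<Sum>i\<le>degree p. monom (b (Suc i) * coeff p i) (Suc i)) (Suc n)
      = (\<Sum>i\<le>degree p. if i = n then b (Suc i) * coeff p i else 0)"
      by (simp add: coeff_sum)
    also have "\<dots> = b (Suc n) * coeff p n"
      by (simp add: coeff_eq_0)
    finally show "coeff (pderiv (\<Sum>i\<le>degree p. monom (b (Suc i) * coeff p i) (Suc i))) n = coeff p n"
      using b[of "Suc n"] by (simp only: coeff_pderiv mult.assoc[symmetric]) simp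
  qed
  then show ?thesis by blast
qed

lemma map_poly_surj:
  assumes d0: "d 0 = 0" and s: "\<And>p. \<exists>q. d q = p"
  shows "\<exists>q. map_poly d q = p"
proof (induction p)
  case 0
  then show ?case by (intro exI[of _ 0]) simp
next
  case (pCons a p)
  then obtain q where "map_poly d q = p" by blast
  moreover obtain b where "d b = a" using s by blast
  ultimately show ?case by (intro exI[of _ "pCons b q"]) (simp add: map_poly_pCons d0)
qed

lemma dd_surj:
  fixes p :: "'a::idom poly poly poly"
  assumes Q: "Q_domain TYPE('a)"
  shows "\<exists>q. dd1 q = p" "\<exists>q. dd2 q = p" "\<exists>q. dd3 q = p"
  unfolding dd1_def dd2_def dd3_def
  by (intro map_poly_surj pderiv_surj Q_domain_poly Q; simp)+

lemma alg_closed_induct [consumes 1, case_names const root]: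
  fixes e :: "'k::alg_closed_field poly"
  assumes "e \<noteq> 0" and "\<And>c. c \<noteq> 0 \<Longrightarrow> Pr [:c:]"
    and "\<And>l e. e \<noteq> 0 \<Longrightarrow> Pr e \<Longrightarrow> Pr ([:- l, 1:] * e)"
  shows "Pr e"
  using assms(1)
proof (induction "degree e" arbitrary: e rule: less_induct)
  case less
  show ?case
  proof (cases "degree e = 0")
    case True
    then obtain c where "e = [:c:]" by (metis degree_eq_zeroE)
    then show ?thesis using less assms(2) by auto
  next
    case False
    then obtain l where "poly e l = 0" using alg_closed_imp_poly_has_root[of e] by auto
    then obtain e' where e': "e = [:- l, 1:] * e'" by (auto simp: poly_eq_0_iff_dvd elim: dvdE)
    then have "e' \<noteq> 0" using less by auto
    then have "degree e = 1 + degree e'" unfolding e' by (subst degree_mult_eq) auto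
    then show ?thesis using less(1)[of e'] \<open>e' \<noteq> 0\<close> assms(3) e' by auto
  qed
qed

text \<open>Since \<open>x - l\<close> divides \<open>phi - phi(l)\<close>, each root
  \<open>l\<close> of \<open>psi\<close> contributes one factor \<open>T - phi(l)\<close> to
  \<open>c\<close>.\<close>

lemma dvd_pcompose_ex:
  fixes psi :: "'k::alg_closed_field poly"
  assumes "psi \<noteq> 0"
  shows "\<exists>c. c \<noteq> 0 \<and> psi dvd pcompose c phi"
  using assms
proof (induction psi rule: alg_closed_induct)
  case (const c)
  then show ?case by (intro exI[of _ 1]) (simp add: pcompose_1 is_unit_const_poly_iff dvd_field_iff)
next
  case (root l e)
  then obtain c where c: "c \<noteq> 0" "e dvd pcompose c phi" by blast
  have "[:- l, 1:] dvd phi - [:poly phi l:]"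
    by (simp add: poly_eq_0_iff_dvd[symmetric])
  then have "[:- l, 1:] * e dvd (phi - [:poly phi l:]) * pcompose c phi"
    using c by (intro mult_dvd_mono)
  also have "(phi - [:poly phi l:]) * pcompose c phi = pcompose ([:- poly phi l, 1:] * c) phi"
    by (simp only: pcompose_mult) (simp add: pcompose_pCons)
  finally have "[:- l, 1:] * e dvd pcompose ([:- poly phi l, 1:] * c) phi" .
  moreover have "[:- poly phi l, 1:] * c \<noteq> 0" using c by (simp only: mult_eq_0_iff) simp
  ultimately show ?case by blast
qed

abbreviation cx :: "'a::comm_ring_1 poly \<Rightarrow> 'a poly poly poly" where
  "cx p \<equiv> [:[:p:]:]"

lemma is_hom_cx: "is_hom cx"
  by (rule is_hom_comp[OF is_hom_const is_hom_const])

lemma cx_mult: "cx (p * q) = cx p * cx q"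
  and cx_add: "cx (p + q) = cx p + cx q"
  by simp_all

section \<open>Reduction modulo \<open>x - l\<close>\<close>

definition spec3 :: "'k::comm_ring_1 \<Rightarrow> 'k poly poly poly \<Rightarrow> 'k poly poly" where
  "spec3 l = map_poly (map_poly (\<lambda>p. poly p l))"

definition spec2 :: "'k::comm_ring_1 \<Rightarrow> 'k poly poly \<Rightarrow> 'k poly" where
  "spec2 l = map_poly (\<lambda>p. poly p l)"

lemma is_hom_spec3: "is_hom (spec3 l)" and is_hom_spec2: "is_hom (spec2 l)"
  unfolding spec3_def spec2_def by (intro is_hom_map_poly is_hom_poly)+

lemma spec3_pCons [simp]: "spec3 l (pCons a p) = pCons (spec2 l a) (spec3 l p)"
  and spec2_pCons [simp]: "spec2 l (pCons b q) = pCons (poly b l) (spec2 l q)"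
  and spec3_0 [simp]: "spec3 l 0 = 0"
  and spec2_0 [simp]: "spec2 l 0 = 0"
  by (simp_all add: spec3_def spec2_def map_poly_pCons)

lemma spec2_eq_0:
  fixes q :: "'k::idom poly poly"
  assumes "spec2 l q = 0"
  shows "\<exists>q'. q = [:[:- l, 1:]:] * q'"
proof -
  have "poly (coeff q n) l = 0" for n
    using assms coeff_map_poly[of "\<lambda>p. poly p l" q n] by (simp add: spec2_def)
  then show ?thesis by (metis const_poly_dvd_iff poly_eq_0_iff_dvd dvdE)
qed

lemma spec3_eq_0:
  fixes q :: "'k::idom poly poly poly"
  assumes "spec3 l q = 0"
  shows "\<exists>q'. q = cx [:- l, 1:] * q'"
proof -
  have "spec2 l (coeff q n) = 0" for n
    using assms coeff_map_poly[of "map_poly (\<lambda>p. poly p l)" q n] by (simp add: spec3_def spec2_def)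
  then have "[:[:- l, 1:]:] dvd coeff q n" for n
    using spec2_eq_0[of l "coeff q n"] by (metis dvdI)
  then have "cx [:- l, 1:] dvd q" by (simp add: const_poly_dvd_iff[of "[:[:- l, 1:]:]"])
  then show ?thesis by (metis dvdE)
qed

lemma spec3_cx [simp]: "spec3 l (cx p) = [:[:poly p l:]:]" by simp

lemma spec2_pderiv: "spec2 l (pderiv p) = pderiv (spec2 l p)"
  by (induction p) (simp_all add: pderiv_pCons hom_add[OF is_hom_spec2])

lemma pcompose_eq_0': "pcompose p q = 0 \<Longrightarrow> degree q > 0 \<Longrightarrow> p = (0::'a::idom poly)"
  by (rule pcompose_eq_0) auto

text \<open>The derivation is f d/dy + g d/dz with x innermost and z outermost. Taking an
  antiderivative \<open>G\<close> of g in y as datum makes the kernel element \<open>P\<close>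
  explicit; the last assumption says that no \<open>x - l\<close> divides both f and g.\<close>

locale triangular =
  fixes f :: "'k::alg_closed_field poly" and G :: "'k poly poly"
  assumes Q: "Q_domain TYPE('k)" and f0: "f \<noteq> 0"
    and no_common_root: "poly f l = 0 \<Longrightarrow> pderiv (spec2 l G) \<noteq> 0"
begin

section \<open>Kernel, cokernel and slices of the reduced derivation\<close>

definition D :: "'k poly poly poly \<Rightarrow> 'k poly poly poly" where
  "D h = cx f * dd2 h + [:pderiv G:] * dd3 h"

definition P :: "'k poly poly poly" where "P = [:- G, [:f:]:]"

definition ev :: "'k poly poly \<Rightarrow> 'k poly poly poly" where
  "ev H = pcompose (map_poly (\<lambda>p. [:p:]) H) P"

lemma is_hom_ev: "is_hom ev"
  unfolding ev_def by (intro is_hom_comp[OF is_hom_pcompose] is_hom_map_poly is_hom_const)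

lemma ev_const: "ev [:p:] = cx p"
  by (simp add: ev_def map_poly_pCons)

lemma ev_X: "ev [:0, 1:] = P"
  by (simp add: ev_def map_poly_pCons pcompose_pCons) (simp flip: one_pCons)

text \<open>At a root \<open>l\<close> of \<open>f\<close>, the element \<open>P\<close> reduces to
  \<open>- spec2 l G\<close>, a polynomial in y with nonzero derivative.\<close>

lemma deg_u: "poly f l = 0 \<Longrightarrow> degree (- spec2 l G) > 0"
  using no_common_root[of l] by (cases "degree (spec2 l G) = 0") (auto elim: degree_eq_zeroE)

lemma is_derivation_D: "is_derivation D"
proof -
  have "D = (\<lambda>h. dd1 h * 0 + dd2 h * cx f + dd3 h * [:pderiv G:])"
    by (rule ext) (simp add: D_def algebra_simps)
  then show ?thesis by (simp only: is_derivation_lin3)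
qed

lemma der_D: "der D" using is_derivation_D by (simp add: is_derivation_iff)

lemmas D_simps = hder_0[OF der_D] hder_add[OF der_D] hder_mult[OF der_D] hder_diff[OF der_D] hder_uminus[OF der_D]

lemma D_X2: "D X2 = cx f" and D_X3: "D X3 = [:pderiv G:]"
  by (simp_all add: D_def)

lemma D_cx [simp]: "D (cx p) = 0"
  by (simp add: D_def dd2_def dd3_def map_poly_pCons)

lemma D_P [simp]: "D P = 0"
  by (simp add: D_def P_def dd2_def dd3_def map_poly_pCons pderiv_pCons pderiv_minus mult.commute)

text \<open>\<open>D\<close> kills \<open>P\<close>, so it acts only on the coefficients of
  \<open>H\<close>; these lie in k[x, y], where \<open>D\<close> is f d/dy.\<close>

lemma D_pcompose: "D (pcompose H P) = cx f * pcompose (dd2 H) P"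
proof (induction H)
  case 0
  then show ?case by (simp add: D_simps dd2_def)
next
  case (pCons a H)
  have "D [:a:] = cx f * [:pderiv a:]"
    by (simp add: D_def dd2_def dd3_def map_poly_pCons)
  then show ?case
    using pCons by (simp add: pcompose_pCons D_simps dd2_def map_poly_pCons algebra_simps del: mult_pCons_left mult_pCons_right)
qed

lemma D_ev [simp]: "D (ev H) = 0"
proof -
  have "dd2 (map_poly (\<lambda>p. [:p:]) H) = 0"
    unfolding dd2_def by (rule poly_eqI) (simp add: coeff_map_poly)
  then show ?thesis by (simp add: ev_def D_pcompose)
qed

text \<open>After inverting \<open>f\<close>, z = (P + G) / f, so \<open>P\<close> may replace z as
  third coordinate.\<close>

lemma normal_form: "\<exists>N H. cx (f ^ N) * b = pcompose H P"
proof (induction b)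
  case 0
  then show ?case by (intro exI[of _ 0]) simp
next
  case (pCons c b)
  then obtain N H where NH: "cx (f ^ N) * b = pcompose H P" by blast
  have z: "cx f * X3 = P + [:G:]" by (simp add: P_def)
  have "cx (f ^ Suc N) * pCons c b = cx (f ^ Suc N) * [:c:] + (cx f * X3) * (cx (f ^ N) * b)"
    by (subst pCons_conv[of c b]) (simp only: power_Suc cx_mult algebra_simps)
  also have "\<dots> = pcompose ([:[:f ^ Suc N:] * c:] + (X3 + [:G:]) * H) P"
    unfolding z NH by (simp add: pcompose_add pcompose_mult pcompose_pCons del: mult_pCons_left mult_pCons_right) simp
  finally show ?case by blast
qed

lemma degree_P: "degree P = 1"
  using f0 by (simp add: P_def)

lemma spec3_ev:
  assumes "poly f l = 0"
  shows "spec3 l (ev H) = [:pcompose (spec2 l H) (- spec2 l G):]"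
proof (rule hom_poly_eqI[of "\<lambda>H. spec3 l (ev H)" "\<lambda>H. [:pcompose (spec2 l H) (- spec2 l G):]"])
  show "is_hom (\<lambda>H. spec3 l (ev H))" by (rule is_hom_comp[OF is_hom_spec3 is_hom_ev])
  show "is_hom (\<lambda>H. [:pcompose (spec2 l H) (- spec2 l G):])"
    by (rule is_hom_comp[OF is_hom_const is_hom_comp[OF is_hom_pcompose is_hom_spec2]])
  show "spec3 l (ev [:0, 1:]) = [:pcompose (spec2 l [:0, 1:]) (- spec2 l G):]"
    unfolding ev_X by (simp add: P_def assms pcompose_pCons hom_uminus[OF is_hom_spec2])
qed (simp add: ev_const)

text \<open>In normal form the condition means independence of y, so some f^N b is a polynomial in x
  and P. The linear factors of f^N are then cancelled one by one: modulo \<open>x - l\<close> the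
  element \<open>P\<close> is nonconstant in y, so H(l, P) = 0 forces H(l, T) = 0.\<close>

lemma ker_D:
  assumes "D b = 0"
  shows "\<exists>H. b = ev H"
proof -
  obtain N H where NH: "cx (f ^ N) * b = pcompose H P" using normal_form by blast
  have "cx f * pcompose (dd2 H) P = 0"
    unfolding D_pcompose[symmetric] NH[symmetric] D_simps using assms by simp
  then have "pcompose (dd2 H) P = 0" using f0 by simp
  then have d0: "dd2 H = 0" by (rule pcompose_eq_0') (simp add: degree_P)
  have c: "coeff H n = [:poly (coeff H n) 0:]" for n
  proof -
    have "pderiv (coeff H n) = 0"
      using d0 coeff_map_poly[of pderiv H n] by (simp add: dd2_def)
    then have "degree (coeff H n) = 0"
      by (rule pderiv_eq_0_char0[rotated]) (simp add: Q_domain_char[OF Q])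
    then show ?thesis by (auto elim: degree_eq_zeroE)
  qed
  have "H = map_poly (\<lambda>p. [:p:]) (map_poly (\<lambda>q. poly q 0) H)"
    by (rule poly_eqI) (use c in \<open>simp add: coeff_map_poly\<close>)
  then have "cx (f ^ N) * b = ev (map_poly (\<lambda>q. poly q 0) H)"
    unfolding NH ev_def by simp
  moreover have *: "\<exists>H. b = ev H"
    if "e \<noteq> 0" "cx e * b = ev H" "\<And>l. poly e l = 0 \<Longrightarrow> poly f l = 0" for e H
    using that
  proof (induction e arbitrary: H rule: alg_closed_induct)
    case (const c)
    have "b = cx [:inverse c:] * (cx [:c:] * b)" using const(1) by (simp flip: one_pCons)
    also have "\<dots> = ev ([:[:inverse c:]:] * H)"
      unfolding const(2) by (simp only: hom_mult[OF is_hom_ev] ev_const)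
    finally show ?case by blast
  next
    case (root l e)
    have l: "poly f l = 0" using root by simp
    have "spec3 l (ev H) = 0"
      unfolding root(3)[symmetric] hom_mult[OF is_hom_spec3] by simp
    then have "spec2 l H = 0"
      unfolding spec3_ev[OF l] using deg_u[OF l] by (auto dest: pcompose_eq_0')
    then obtain H' where H': "H = [:[:- l, 1:]:] * H'" using spec2_eq_0 by blast
    have "cx [:- l, 1:] * (cx e * b) = cx [:- l, 1:] * ev H'"
      using root(3) unfolding H' hom_mult[OF is_hom_ev] ev_const cx_mult mult.assoc .
    then have "cx e * b = ev H'"
      by (simp only: mult_cancel_left) simp
    then show ?case using root by simp
  qed
  ultimately show ?thesis using f0 by (intro *[of "f ^ N"]) auto
qed

text \<open>In normal form \<open>D\<close> is f d/dy, and antiderivatives in y exist.\<close>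

lemma torsion: "\<exists>N s. cx (f ^ N) * b = D s"
proof -
  obtain N H where NH: "cx (f ^ N) * b = pcompose H P" using normal_form by blast
  obtain H1 where "dd2 H1 = H" using dd_surj(2)[OF Q] by blast
  then have "cx (f ^ Suc N) * b = D (pcompose H1 P)"
    unfolding D_pcompose by (simp only: NH[symmetric] power_Suc cx_mult mult.assoc)
  then show ?thesis by blast
qed

text \<open>At a root \<open>l\<close> of \<open>f\<close> the reduction of \<open>pderiv G\<close>
  is nonzero, so \<open>t\<close> must vanish modulo \<open>x - l\<close>; the linear factors of
  \<open>f\<close> are split off in turn.\<close>

lemma f_dvd:
  assumes "cx f * a = t * [:pderiv G:]"
  shows "\<exists>psi. t = cx f * psi"
proof -
  have "\<exists>psi. t = cx e * psi"
    if "e \<noteq> 0" "cx e * a = t * [:pderiv G:]" "\<And>l. poly e l = 0 \<Longrightarrow> poly f l = 0" for e t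
    using that
  proof (induction e arbitrary: t rule: alg_closed_induct)
    case (const c)
    have "t = cx [:c:] * (cx [:inverse c:] * t)"
      using const(1) by (simp flip: one_pCons)
    then show ?case by blast
  next
    case (root l e)
    have l: "poly f l = 0" using root by simp
    have "spec3 l (t * [:pderiv G:]) = 0"
      unfolding root(3)[symmetric] hom_mult[OF is_hom_spec3] by simp
    then have "spec3 l t = 0"
      unfolding hom_mult[OF is_hom_spec3] using no_common_root[OF l] by (simp add: spec2_pderiv)
    then obtain t' where t': "t = cx [:- l, 1:] * t'" using spec3_eq_0 by blast
    have "cx [:- l, 1:] * (cx e * a) = cx [:- l, 1:] * (t' * [:pderiv G:])"
      using root(3) unfolding t' cx_mult mult.assoc .
    then have "cx e * a = t' * [:pderiv G:]"
      by (simp only: mult_cancel_left) simp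
    then obtain psi where "t' = cx e * psi" using root(2)[of t'] root(4) by auto
    then show ?case unfolding t' cx_mult mult.assoc by blast
  qed
  then show ?thesis using assms f0 by blast
qed

text \<open>\<open>D\<close> does not raise the degree in z, so \<open>v\<close> would be free of z;
  on the leading coefficient \<open>D\<close> is f d/dy, which lowers the degree in y, whereas
  multiplication by a nonzero element does not.\<close>

lemma D_dvd_imp_0:
  assumes "D w = w * v"
  shows "w * v = 0"
proof (rule ccontr)
  assume "w * v \<noteq> 0"
  then have w: "w \<noteq> 0" and v: "v \<noteq> 0" by auto
  have cD: "coeff (D w) n = [:f:] * pderiv (coeff w n)" if "n \<ge> degree w" for n
    using that by (simp add: D_def dd2_def dd3_def coeff_map_poly coeff_pderiv coeff_eq_0)
  have "degree (w * v) \<le> degree w"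
    unfolding assms[symmetric] by (rule degree_le) (simp add: cD coeff_eq_0)
  then have "degree v = 0" using w v by (simp add: degree_mult_eq)
  then obtain v0 where v0: "v = [:v0:]" by (metis degree_eq_zeroE)
  let ?c = "lead_coeff w"
  have eq: "[:f:] * pderiv ?c = ?c * v0"
    using cD[of "degree w"] unfolding assms v0 by (simp add: mult.commute)
  have nz: "?c * v0 \<noteq> 0" using w v v0 by auto
  then have "pderiv ?c \<noteq> 0" unfolding eq[symmetric] by auto
  then have "degree ?c \<noteq> 0" by (metis degree_eq_zeroE pderiv_singleton)
  then have "degree ([:f:] * pderiv ?c) < degree ?c"
    using degree_pderiv_less[of ?c] f0 by simp
  then show False unfolding eq using nz by (simp add: degree_mult_eq)
qed

text \<open>Each application lowers the degree in y of the top coefficient, until the degree in z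
  drops.\<close>

lemma D_nilpotent: "\<exists>n. (D ^^ n) b = 0"
proof (induction "degree b" arbitrary: b rule: less_induct)
  case less
  define m where "m = degree b"
  have cD: "coeff (D h) n = [:f:] * pderiv (coeff h n)" if "n \<ge> degree h" for n h
    using that by (simp add: D_def dd2_def dd3_def coeff_map_poly coeff_pderiv coeff_eq_0)
  have dD: "degree (D h) \<le> degree h" for h
    by (rule degree_le) (simp add: cD coeff_eq_0)
  have dn: "degree ((D ^^ n) b) \<le> m" for n
    by (induction n) (use dD order_trans in \<open>auto simp: m_def\<close>)
  have top: "coeff ((D ^^ n) b) m = 0" if "degree (coeff b m) < n" for n
  proof -
    have "coeff ((D ^^ n) b) m = 0 \<or> degree (coeff ((D ^^ n) b) m) + n \<le> degree (coeff b m)" for n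
    proof (induction n)
      case (Suc n)
      let ?c = "coeff ((D ^^ n) b) m"
      have eq: "coeff ((D ^^ Suc n) b) m = [:f:] * pderiv ?c"
        using cD[OF dn[of n]] by simp
      show ?case
      proof (cases "degree ?c = 0")
        case True
        then show ?thesis unfolding eq by (auto elim: degree_eq_zeroE)
      next
        case False
        then have "?c \<noteq> 0" by auto
        then show ?thesis unfolding eq using Suc degree_pderiv_less[OF False] f0 by auto
      qed
    qed simp
    from this[of n] that show ?thesis by linarith
  qed
  define n where "n = Suc (degree (coeff b m))"
  have t: "coeff ((D ^^ n) b) m = 0" by (rule top) (simp add: n_def)
  show ?case
  proof (cases "(D ^^ n) b = 0")
    case False
    then have "degree ((D ^^ n) b) < m" using dn[of n] t by (metis leading_coeff_0_iff le_neq_implies_less)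
    then obtain k where "(D ^^ k) ((D ^^ n) b) = 0" using less m_def by blast
    then have "(D ^^ (k + n)) b = 0" by (simp add: funpow_add)
    then show ?thesis by blast
  qed blast
qed

lemma eval3_ev: "eval3 [:H:] X1 P s = ev H"
proof (rule hom_poly_eqI[of "\<lambda>H. eval3 [:H:] X1 P s" ev])
  show "is_hom (\<lambda>H. eval3 [:H:] X1 P s)" by (rule is_hom_comp[OF is_hom_eval3 is_hom_const])
  fix c
  show "eval3 [:[:c:]:] X1 P s = ev [:c:]"
    unfolding ev_const
    by (rule hom_poly_eqI[of "\<lambda>c. eval3 (cx c) X1 P s" cx])
      (auto simp: is_hom_cx intro!: is_hom_comp[OF is_hom_eval3 is_hom_cx] simp flip: C3_def)
qed (simp_all add: is_hom_ev ev_X)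

text \<open>The slice theorem, by induction on the nilpotency order of \<open>b\<close>: integrating
  the expression of \<open>D b\<close> with respect to \<open>s\<close> leaves a kernel element,
  which \<open>ker_D\<close> describes.\<close>

lemma slice_coord3:
  assumes s: "D s = 1"
  shows "coord3 X1 P s"
proof -
  have D1: "D X1 = 0" by simp
  have ex: "\<exists>a. b = eval3 a X1 P s" if "(D ^^ n) b = 0" for n b
    using that
  proof (induction n arbitrary: b)
    case 0
    then show ?case by (intro exI[of _ 0]) (simp add: eval3_simps)
  next
    case (Suc n)
    then have "(D ^^ n) (D b) = 0" by (simp add: funpow_swap1)
    then obtain a where a: "D b = eval3 a X1 P s" using Suc by blast
    obtain a1 where a1: "dd3 a1 = a" using dd_surj(3)[OF Q] by blast
    have "D (eval3 a1 X1 P s) = D b"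
      using derivation_eval3[OF is_derivation_D, of a1 X1 P s] by (simp only: D1 D_P s a a1) simp
    then have "D (b - eval3 a1 X1 P s) = 0" by (simp only: D_simps) simp
    then obtain H where "b - eval3 a1 X1 P s = ev H" using ker_D by blast
    then have "b = eval3 (a1 + [:H:]) X1 P s"
      by (simp only: eval3_simps eval3_ev) (simp add: algebra_simps)
    then show ?case by blast
  qed
  have "\<exists>a. b = eval3 a X1 P s" for b using D_nilpotent[of b] ex by blast
  then show ?thesis unfolding coord3_def by auto
qed

end

section \<open>A variable in the kernel forces a slice\<close>

text \<open>The last two assumptions are all that is used of the degrees in \<open>k[X, Y, Z]\<close>.\<close>
locale triangular_coords = triangular f G for f :: "'k::alg_closed_field poly" and G +
  fixes dY dZ :: "'k poly poly poly \<Rightarrow> 'k poly poly poly" and X Y Z :: "'k poly poly poly"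
  assumes der_dY: "is_derivation dY" and der_dZ: "is_derivation dZ"
    and comm: "dY (dZ h) = dZ (dY h)"
    and dY_surj: "\<exists>h'. dY h' = h"
    and dX: "dY X = 0" "dZ X = 0" and dYY: "dY Y = 1" "dZ Y = 0" and dZZ: "dY Z = 0" "dZ Z = 1"
    and D_XYZ: "D h = D Y * dY h + D Z * dZ h"
    and X_notin: "X \<notin> range cx"
    and dvd_partials: "cx [:- l, 1:] dvd dY X1 \<Longrightarrow> cx [:- l, 1:] dvd dZ X1 \<Longrightarrow> X \<in> range cx"
    and dvd_fibre: "cx [:- l, 1:] dvd X - C3 nu \<Longrightarrow> X \<in> range cx"
begin

lemma derY: "der dY" and derZ: "der dZ"
  using der_dY der_dZ by (simp_all add: is_derivation_iff)

lemmas dY_simps = hder_0[OF derY] hder_add[OF derY] hder_mult[OF derY] hder_diff[OF derY] hder_uminus[OF derY]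
lemmas dZ_simps = hder_0[OF derZ] hder_add[OF derZ] hder_mult[OF derZ] hder_diff[OF derZ] hder_uminus[OF derZ]

abbreviation a where "a \<equiv> D Y"
abbreviation b where "b \<equiv> D Z"

lemma D_X: "D X = 0" using D_XYZ[of X] by (simp add: dX)

text \<open>Exactness of the Koszul complex of \<open>a\<close>, \<open>b\<close>. The derivation
  \<open>Psi\<close> is proportional to \<open>D\<close>, and comparing values on \<open>X2\<close>
  and \<open>X3\<close> with the help of \<open>f_dvd\<close> makes it a multiple of
  \<open>D\<close>.\<close>

lemma koszul:
  assumes pr: "a * p + b * r = 0"
  shows "\<exists>psi. p = psi * b \<and> r = - psi * a"
proof -
  define Psi where "Psi h = p * dZ h - r * dY h" for h
  \<comment> \<open>The coefficients of \<open>D\<close> and \<open>Psi\<close> with respect to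
    \<open>dY\<close>, \<open>dZ\<close> have determinant \<open>a * p + b * r\<close>.\<close>
  have proport: "D u * Psi h = Psi u * D h" for u h
  proof -
    have "D u * Psi h - Psi u * D h = (a * p + b * r) * (dY u * dZ h - dY h * dZ u)"
      unfolding Psi_def D_XYZ[of u] D_XYZ[of h] by (simp only: algebra_simps)
    then show ?thesis using pr by simp
  qed
  obtain psi where psi: "Psi X2 = cx f * psi"
    using f_dvd[of "Psi X3" "Psi X2"] proport[of X2 X3] unfolding D_X2 D_X3 by blast
  have "cx f * Psi h = cx f * (psi * D h)" for h
    using proport[of X2 h] unfolding D_X2 psi by (simp only: mult.assoc)
  moreover have "cx f \<noteq> 0" using f0 by simp
  ultimately have "Psi h = psi * D h" for h by (metis mult_left_cancel)
  from this[of Y] this[of Z] have "- r = psi * a" "p = psi * b"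
    by (simp_all add: Psi_def dYY dZZ)
  moreover from this(1) have "r = - psi * a" by (metis minus_mult_left minus_minus)
  ultimately show ?thesis by blast
qed

section \<open>Elements of k[X] and the differential of x over k[X]\<close>

definition cX :: "'k poly \<Rightarrow> 'k poly poly poly" where
  "cX c = poly (map_poly C3 c) X"

lemma is_hom_cX: "is_hom cX"
  unfolding cX_def by (rule is_hom_eval[OF is_hom_C3])

lemma cX_basic: "cX [:c:] = C3 c" "cX [:0, 1:] = X"
  by (simp_all add: cX_def is_hom_C3 hom_0[OF is_hom_C3] hom_1[OF is_hom_C3])

lemma d_cX:
  assumes "is_derivation d" "d X = 0"
  shows "d (cX c) = 0"
proof (induction c)
  case 0
  then show ?case using assms by (simp add: hom_0[OF is_hom_cX] is_derivation_iff hder_0[of "\<lambda>x. x" d])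
next
  case (pCons e c)
  have d: "der d" using assms by (simp add: is_derivation_iff)
  show ?case
    unfolding pCons_conv[of e c] hom_add[OF is_hom_cX] hom_mult[OF is_hom_cX] cX_basic
      hder_add[OF d] hder_mult[OF d] using assms pCons by (simp add: is_derivation_iff)
qed

lemma D_ker_mult: "D e = 0 \<Longrightarrow> D (e * h) = e * D h"
  by (simp add: D_simps)

text \<open>By \<open>koszul\<close>, D x = 0 gives dx = w (b dY - a dZ). Equality of mixed partials
  then reads D w = - w (dY a + dZ b), so \<open>D_dvd_imp_0\<close> puts w into the kernel and makes
  \<open>D\<close> divergence-free. A factor \<open>x - l\<close> of w would divide both partials of
  x.\<close>

lemma ex_w: "\<exists>W. dY X1 = ev W * b \<and> dZ X1 = - ev W * a \<and> (\<forall>l. spec2 l W \<noteq> 0) \<and> dY a + dZ b = 0"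
proof -
  have "a * dY X1 + b * dZ X1 = 0" using D_XYZ[of X1] by simp
  then obtain w where w: "dY X1 = w * b" "dZ X1 = - w * a" using koszul by blast
  have nd: "\<not> cx [:- l, 1:] dvd w" for l
    using dvd_partials[of l] w X_notin by auto
  then have w0: "w \<noteq> 0" by auto
  have "dZ (w * b) = dY (- w * a)"
    unfolding w[symmetric] by (rule comm[symmetric])
  then have dw: "a * dY w + b * dZ w = w * - (dY a + dZ b)"
    by (simp add: dY_simps dZ_simps algebra_simps add_eq_0_iff)
  then have "D w = w * - (dY a + dZ b)" by (simp only: D_XYZ[of w])
  moreover from D_dvd_imp_0[OF this] have "- (dY a + dZ b) = 0" using w0 by (simp only: mult_eq_0_iff) simp
  then have div: "dY a + dZ b = 0" by (simp only: neg_equal_0_iff_equal)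
  ultimately have "D w = 0" by (simp only: div) simp
  then obtain W where W: "w = ev W" using ker_D by blast
  have "spec2 l W \<noteq> 0" for l
  proof
    assume "spec2 l W = 0"
    then obtain W' where "W = [:[:- l, 1:]:] * W'" using spec2_eq_0 by blast
    then have "w = cx [:- l, 1:] * ev W'" unfolding W by (simp only: hom_mult[OF is_hom_ev] ev_const)
    then have "cx [:- l, 1:] dvd w" by (metis dvd_triv_left)
    then show False using nd by blast
  qed
  then show ?thesis using w div W by blast
qed

definition W where "W = (SOME W. dY X1 = ev W * b \<and> dZ X1 = - ev W * a \<and> (\<forall>l. spec2 l W \<noteq> 0) \<and> dY a + dZ b = 0)"

lemma W: "dY X1 = ev W * b" "dZ X1 = - ev W * a" "spec2 l W \<noteq> 0" "dY a + dZ b = 0"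
  using someI_ex[OF ex_w] unfolding W_def[symmetric] by blast+

lemma d_cx:
  fixes d :: "'k poly poly poly \<Rightarrow> 'k poly poly poly"
  assumes "is_derivation d"
  shows "d (cx p) = cx (pderiv p) * d X1"
proof -
  have "der d" and C: "\<And>c. d (C3 c) = 0" using assms by (simp_all add: is_derivation_iff)
  then have h: "hder cx (\<lambda>p. d (cx p))" by (intro hder_comp_hom[of "\<lambda>x. x", OF _ is_hom_cx]) auto
  have "hder cx (\<lambda>p. cx (pderiv p) * d X1)"
    unfolding hder_def pderiv_add pderiv_mult cx_add cx_mult by (simp only: distrib_right mult.assoc simp_thms)
  then show ?thesis
  proof (rule hder_poly_eqI[OF h])
    fix c
    show "d (cx [:c:]) = cx (pderiv [:c:]) * d X1"
      using C[of c] by (simp add: C3_def)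
  qed (simp add: pderiv_pCons, simp flip: one_pCons)
qed

text \<open>Over k[X], the differential of e(x) c(X) is e'(x) w c(X) times b dY - a dZ, the shape
  required by \<open>gm_mult\<close>.\<close>

lemma dY_coeff: "dY (cx e * cX c) = cx (pderiv e) * ev W * cX c * b"
  and dZ_coeff: "dZ (cx e * cX c) = - (cx (pderiv e) * ev W * cX c) * a"
  by (simp_all only: hder_mult[OF derY] hder_mult[OF derZ] d_cx[OF der_dY, of e] d_cx[OF der_dZ, of e]
    d_cX[OF der_dY dX(1)] d_cX[OF der_dZ dX(2)] W(1,2) mult_zero_right mult_zero_left add_0_left add_0_right mult_minus_left mult_minus_right mult_ac)

definition F where "F = (SOME F. X = ev F)"

lemma F: "X = ev F"
  unfolding F_def by (rule someI_ex[OF ker_D[OF D_X]])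

text \<open>If F(l, T) were a constant nu, then \<open>x - l\<close> would divide X - nu, against
  \<open>dvd_fibre\<close>.\<close>

lemma spec2_F: "degree (spec2 l F) > 0"
proof (rule ccontr)
  assume "\<not> degree (spec2 l F) > 0"
  then obtain nu where nu: "spec2 l F = [:nu:]" by (auto elim: degree_eq_zeroE)
  then have "spec2 l (F - [:[:nu:]:]) = 0" by (simp add: hom_diff[OF is_hom_spec2])
  then obtain F' where "F - [:[:nu:]:] = [:[:- l, 1:]:] * F'" using spec2_eq_0 by blast
  then have "ev (F - [:[:nu:]:]) = cx [:- l, 1:] * ev F'"
    by (simp only: hom_mult[OF is_hom_ev] ev_const)
  then have "X - C3 nu = cx [:- l, 1:] * ev F'"
    by (simp only: hom_diff[OF is_hom_ev] ev_const F[symmetric] C3_def)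
  then show False using dvd_fibre X_notin by (metis dvdI)
qed

definition cF :: "'k poly \<Rightarrow> 'k poly poly" where
  "cF c = pcompose (map_poly (\<lambda>c. [:c:]) c) F"

lemma is_hom_cF: "is_hom cF"
  unfolding cF_def by (intro is_hom_comp[OF is_hom_pcompose] is_hom_map_poly is_hom_const)

lemma cF_basic: "cF [:c:] = [:[:c:]:]" "cF [:0, 1:] = F"
  by (simp_all add: cF_def map_poly_pCons pcompose_pCons) (simp flip: one_pCons)

lemma cX_ev: "cX c = ev (cF c)"
  by (rule hom_poly_eqI[of cX "\<lambda>c. ev (cF c)"])
     (simp_all add: is_hom_cX is_hom_comp[OF is_hom_ev is_hom_cF] cX_basic cF_basic ev_const C3_def F[symmetric])

lemma spec2_cF: "spec2 l (cF c) = pcompose c (spec2 l F)"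
  by (rule hom_poly_eqI[of "\<lambda>c. spec2 l (cF c)" "\<lambda>c. pcompose c (spec2 l F)"])
     (simp_all add: is_hom_pcompose is_hom_comp[OF is_hom_spec2 is_hom_cF] cF_basic pcompose_pCons)

text \<open>Modulo \<open>x - l\<close>, w and X become W(l, P) and F(l, P), and W(l, T) divides
  c(F(l, T)) for some nonzero c. So the ideal generated by w and \<open>x - l\<close> in the kernel
  contains c(X).\<close>

lemma elimination: "\<exists>c A B. c \<noteq> 0 \<and> cX c = ev W * ev B + cx [:- l, 1:] * ev A"
proof -
  obtain c where c: "c \<noteq> 0" "spec2 l W dvd pcompose c (spec2 l F)"
    using dvd_pcompose_ex[OF W(3)] by blast
  then obtain B0 where B0: "pcompose c (spec2 l F) = spec2 l W * B0" by (auto elim: dvdE)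
  define B where "B = map_poly (\<lambda>c. [:c:]) B0"
  have "spec2 l B = B0"
    unfolding spec2_def B_def by (simp add: map_poly_map_poly o_def)
  then have "spec2 l (cF c - W * B) = 0"
    by (simp add: hom_diff[OF is_hom_spec2] hom_mult[OF is_hom_spec2] spec2_cF B0)
  then obtain A where "cF c - W * B = [:[:- l, 1:]:] * A" using spec2_eq_0 by blast
  then have "cF c = W * B + [:[:- l, 1:]:] * A" by (simp only: diff_eq_eq add.commute)
  then have "cX c = ev W * ev B + cx [:- l, 1:] * ev A"
    by (simp only: cX_ev hom_add[OF is_hom_ev] hom_mult[OF is_hom_ev] ev_const)
  then show ?thesis using c by blast
qed

text \<open>The relative form \<open>\<omega> = b d(Y) - a d(Z)\<close> over \<open>k[X]\<close> is closed, say \<open>\<omega> = dt\<close>, and \<open>D\<close> is the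
  Jacobian derivation of \<open>t\<close>. The relation below says \<open>h d(Y) \<and> d(Z) = d\<eta>\<close> and
  \<open>h' d(Y) \<and> d(Z) = dt \<and> \<eta>\<close> for some \<open>\<eta> = n1 d(Y) + n2 d(Z)\<close>: it is the inverse of the
  Gauss-Manin connection on \<open>B / D B\<close>.\<close>
definition gm :: "'k poly poly poly \<Rightarrow> 'k poly poly poly \<Rightarrow> bool" where
  "gm h h' \<longleftrightarrow> (\<exists>n1 n2. h = dY n2 - dZ n1 \<and> h' = b * n2 + a * n1)"

lemma gm_total: "\<exists>h'. gm h h'"
proof -
  obtain n2 where "dY n2 = h" using dY_surj by blast
  then have "gm h (b * n2)" unfolding gm_def by (intro exI[of _ 0] exI[of _ n2]) (simp add: dZ_simps)
  then show ?thesis by blast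
qed

text \<open>If the wedge product of dt with eta - d(phi) vanishes, \<open>koszul\<close> gives eta =
  d(phi) + psi dt. As dt is closed, d(eta) is then the wedge product of d(psi) and dt, which
  represents \<open>D (- psi)\<close>.\<close>

lemma gm_inj:
  assumes "gm h h'" "h' \<in> range D"
  shows "h \<in> range D"
proof -
  obtain n1 n2 where n: "h = dY n2 - dZ n1" "h' = b * n2 + a * n1" using assms unfolding gm_def by blast
  obtain phi where phi: "h' = D phi" using assms by blast
  have "a * (n1 - dY phi) + b * (n2 - dZ phi) = 0"
    using n(2) unfolding phi D_XYZ[of phi] by (simp add: algebra_simps)
  then obtain psi where "n1 - dY phi = psi * b" "n2 - dZ phi = - psi * a" using koszul by blast
  then have n12: "n1 = dY phi + psi * b" "n2 = dZ phi - psi * a" by (simp_all add: algebra_simps)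
  have "h = - (psi * (dY a + dZ b)) - (a * dY psi + b * dZ psi)"
    unfolding n n12 by (simp add: dY_simps dZ_simps comm algebra_simps)
  also have "\<dots> = D (- psi)" using W(4) D_XYZ[of psi] by (simp add: D_simps)
  finally show ?thesis by blast
qed

text \<open>The Leibniz rule for the form e eta, where de = eps dt.\<close>

lemma gm_mult:
  assumes "gm h h'" "dY e = eps * b" "dZ e = - eps * a"
  shows "gm (e * h + eps * h') (e * h')"
proof -
  obtain n1 n2 where n: "h = dY n2 - dZ n1" "h' = b * n2 + a * n1" using assms unfolding gm_def by blast
  show ?thesis
    unfolding gm_def n
    by (intro exI[of _ "e * n1"] exI[of _ "e * n2"])
       (simp add: dY_simps dZ_simps assms(2,3) algebra_simps)
qed

section \<open>Descent of torsion in B / D B\<close>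

lemma rangeD_add: "h \<in> range D \<Longrightarrow> h' \<in> range D \<Longrightarrow> h + h' \<in> range D"
  and rangeD_diff: "h \<in> range D \<Longrightarrow> h' \<in> range D \<Longrightarrow> h - h' \<in> range D"
  by (auto simp: D_simps(2)[symmetric] D_simps(4)[symmetric])

lemma rangeD_mult: "h \<in> range D \<Longrightarrow> D e = 0 \<Longrightarrow> e * h \<in> range D"
  by (auto simp: D_ker_mult[symmetric] simp del: mult_pCons_left)

lemma D_cX: "D (cX c) = 0"
  by (rule d_cX[OF is_derivation_D D_X])

lemma D_ker_prod: "D e = 0 \<Longrightarrow> D e' = 0 \<Longrightarrow> D (e * e') = 0"
  by (simp add: D_simps)

text \<open>Induction on the torsion order \<open>n\<close> of \<open>h'\<close> at x = l.
  Multiplying the pair by the given annihilator of \<open>h'\<close> puts the second entry into the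
  image, hence also the first by \<open>gm_inj\<close>. For \<open>n = 0\<close> this is a relation
  for \<open>h\<close>; otherwise the \<open>h\<close> term disappears and a relation of lower order
  for \<open>h'\<close> remains.\<close>

lemma descent_step:
  assumes g: "gm h h'"
    and qh: "cx [:- l, 1:] * h \<in> range D"
    and e: "poly e l \<noteq> 0" "c \<noteq> 0" "cx ([:- l, 1:] ^ n * e) * cX c * h' \<in> range D"
  shows "\<exists>c. c \<noteq> 0 \<and> cX c * h \<in> range D"
  using e
proof (induction n arbitrary: e c)
  case 0
  let ?g = "cx e * cX c"
  have "gm (?g * h + cx (pderiv e) * ev W * cX c * h') (?g * h')"
    by (rule gm_mult[OF g])
       (simp_all only: dY_coeff dZ_coeff)
  then have "?g * h + cx (pderiv e) * ev W * cX c * h' \<in> range D"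
    by (rule gm_inj) (use 0 in simp)
  then have "cx e * (?g * h + cx (pderiv e) * ev W * cX c * h') \<in> range D"
    by (rule rangeD_mult) simp
  moreover have "cx (pderiv e) * ev W * (?g * h') \<in> range D"
    by (rule rangeD_mult) (use 0 in \<open>simp_all add: D_ker_prod del: mult_pCons_left\<close>)
  ultimately have "cx e * (?g * h + cx (pderiv e) * ev W * cX c * h') - cx (pderiv e) * ev W * (?g * h') \<in> range D"
    by (rule rangeD_diff)
  then have 1: "cX c * cx (e * e) * h \<in> range D"
    unfolding cx_mult by (simp add: algebra_simps del: mult_pCons_left mult_pCons_right)
  \<comment> \<open>Since (x - l) h is in the image, e^2 may be replaced by its value e(l)^2, a
    nonzero constant.\<close>
  have "[:- l, 1:] dvd e * e - [:poly e l * poly e l:]"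
    by (simp add: poly_eq_0_iff_dvd[symmetric])
  then obtain e' where "e * e - [:poly e l * poly e l:] = [:- l, 1:] * e'" by (elim dvdE)
  then have "e * e = [:poly e l * poly e l:] + [:- l, 1:] * e'" by (simp only: diff_eq_eq add.commute)
  then have "cX c * cx (e * e) * h = cX (c * [:poly e l * poly e l:]) * h + cX c * cx e' * (cx [:- l, 1:] * h)"
    by (simp only: cx_add cx_mult hom_mult[OF is_hom_cX] cX_basic C3_def[symmetric] algebra_simps)
  then have "cX (c * [:poly e l * poly e l:]) * h = cX c * cx (e * e) * h - cX c * cx e' * (cx [:- l, 1:] * h)"
    by simp
  also have "\<dots> \<in> range D"
    by (rule rangeD_diff[OF 1 rangeD_mult[OF qh]]) (simp only: D_ker_prod D_cX D_cx)
  finally show ?case using 0 by (intro exI[of _ "c * [:poly e l * poly e l:]"]) auto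
next
  case (Suc n)
  let ?q = "[:- l, 1:]"
  let ?e = "?q ^ Suc n * e"
  let ?g = "cx ?e * cX c"
  have "gm (?g * h + cx (pderiv ?e) * ev W * cX c * h') (?g * h')"
    by (rule gm_mult[OF g])
       (simp_all only: dY_coeff dZ_coeff)
  then have A: "?g * h + cx (pderiv ?e) * ev W * cX c * h' \<in> range D"
    by (rule gm_inj) (rule Suc(4))
  have eq: "?g * h = cx (?q ^ n * e) * cX c * (cx ?q * h)"
    by (simp only: power_Suc cx_mult mult_ac)
  have B: "cx (?q ^ n * e) * cX c * (cx ?q * h) \<in> range D"
    by (rule rangeD_mult[OF qh D_ker_prod[OF D_cx D_cX]])
  from rangeD_diff[OF A B] have "cx (pderiv ?e) * ev W * cX c * h' \<in> range D"
    unfolding eq add_diff_cancel_left' .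
  then have 1: "cx e * (cx (pderiv ?e) * ev W * cX c * h') \<in> range D"
    by (rule rangeD_mult) (rule D_cx)
  have 2: "ev W * cx (pderiv e) * (cx ?e * cX c * h') \<in> range D"
    by (rule rangeD_mult[OF Suc(4)]) (simp only: D_ker_prod D_ev D_cx)
  have q': "pderiv ?q = 1" by (simp add: pderiv_pCons)
  have pd: "pderiv ?e = ?q ^ Suc n * pderiv e + e * (of_nat (Suc n) * ?q ^ n)"
    by (simp only: pderiv_mult pderiv_power_Suc q' of_nat_poly mult_1_right) simp
  \<comment> \<open>Differentiating (x - l)^(n+1) leaves the integer n + 1, which has to be inverted
    within the kernel of \<open>D\<close>.\<close>
  obtain m where m: "of_nat (Suc n) * m = (1::'k poly poly poly)"
    using Q_domain_poly[OF Q_domain_poly[OF Q_domain_poly[OF Q]]] unfolding Q_domain_def by blast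
  define R where "R = cx (?q ^ n * (e * e)) * cX c * h'"
  have cxn: "cx (of_nat k) = of_nat k" for k by (rule hom_of_nat[OF is_hom_cx])
  have "cx e * (cx (pderiv ?e) * ev W * cX c * h') - ev W * cx (pderiv e) * (cx ?e * cX c * h')
     = of_nat (Suc n) * (ev W * R)"
    unfolding pd R_def cx_add cx_mult cxn by (simp only: algebra_simps)
  then have "of_nat (Suc n) * (ev W * R) \<in> range D" using rangeD_diff[OF 1 2] by simp
  moreover have Dm: "D m = 0"
  proof -
    have "D (of_nat (Suc n) * m) = of_nat (Suc n) * D m"
      by (rule D_ker_mult) (simp only: cxn[symmetric] D_cx)
    then have "of_nat (Suc n) * D m = 0" unfolding m using hder_1[OF der_D is_hom_id] by simp
    then have "m * (of_nat (Suc n) * D m) = 0" by simp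
    then show ?thesis by (metis m mult.assoc mult.commute mult_1)
  qed
  ultimately have "m * (of_nat (Suc n) * (ev W * R)) \<in> range D" by (rule rangeD_mult)
  also have "m * (of_nat (Suc n) * (ev W * R)) = (of_nat (Suc n) * m) * (ev W * R)"
    by (simp only: mult_ac)
  finally have 3: "ev W * R \<in> range D" unfolding m mult_1 .
  have "cx ?q * R = cx e * (cx ?e * cX c * h')"
    unfolding R_def by (simp only: power_Suc cx_mult algebra_simps)
  then have 4: "cx ?q * R \<in> range D" using rangeD_mult[OF Suc(4) D_cx[of e]] by simp
  \<comment> \<open>Both w R and (x - l) R are in the image; \<open>elimination\<close> turns them
    into c'(X) R, a relation of order \<open>n\<close>.\<close>
  obtain c' A B where c': "c' \<noteq> 0" "cX c' = ev W * ev B + cx ?q * ev A" using elimination by blast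
  have "ev B * (ev W * R) + ev A * (cx ?q * R) \<in> range D"
    by (rule rangeD_add[OF rangeD_mult[OF 3] rangeD_mult[OF 4]]) simp_all
  also have "ev B * (ev W * R) + ev A * (cx ?q * R) = cX c' * R"
    unfolding c' by (simp only: algebra_simps)
  also have "cX c' * R = cx (?q ^ n * (e * e)) * cX (c' * c) * h'"
    unfolding R_def hom_mult[OF is_hom_cX] by (simp only: algebra_simps)
  finally have "cx (?q ^ n * (e * e)) * cX (c' * c) * h' \<in> range D" .
  then show ?case using Suc(1)[of "e * e" "c' * c"] Suc(2,3) c'(1) by simp
qed

lemma descent:
  assumes "cx [:- l, 1:] * h \<in> range D"
  shows "\<exists>c. c \<noteq> 0 \<and> cX c * h \<in> range D"
proof -
  obtain h' where h': "gm h h'" using gm_total by blast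
  obtain N s where N: "cx (f ^ N) * h' = D s" using torsion by blast
  obtain e where e: "f ^ N = [:- l, 1:] ^ order l (f ^ N) * e" "\<not> [:- l, 1:] dvd e"
    using order_decomp[of "f ^ N" l] f0 by auto
  show ?thesis
  proof (rule descent_step[OF h' assms])
    show "poly e l \<noteq> 0" using e(2) by (simp add: poly_eq_0_iff_dvd)
    show "cx ([:- l, 1:] ^ order l (f ^ N) * e) * cX 1 * h' \<in> range D"
      unfolding e(1)[symmetric] hom_1[OF is_hom_cX] using N by (simp del: mult_pCons_left)
  qed simp
qed

text \<open>Divide \<open>K\<close> by \<open>C\<close> with remainder. Composed with
  \<open>u\<close>, the remainder has smaller degree than C(u) but equals C(u) (s0 - d(u)), so s0 =
  d(u).\<close>

lemma pcompose_quotient: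
  fixes u C K :: "'k poly"
  assumes "pcompose C u * s0 = pcompose K u" "degree u > 0" "C \<noteq> 0"
  shows "\<exists>d. s0 = pcompose d u"
proof (rule ccontr)
  assume n: "\<nexists>d. s0 = pcompose d u"
  define d where "d = K div C"
  have "pcompose K u = pcompose (C * d + K mod C) u" by (simp add: d_def)
  then have eq: "pcompose C u * (s0 - pcompose d u) = pcompose (K mod C) u"
    unfolding assms(1)[symmetric] by (simp add: pcompose_add pcompose_mult algebra_simps)
  have nz: "s0 - pcompose d u \<noteq> 0" using n by auto
  have Cu: "pcompose C u \<noteq> 0" using pcompose_eq_0'[of C u] assms by auto
  then have r: "K mod C \<noteq> 0" using eq nz by auto
  then have "degree (K mod C) < degree C" using degree_mod_less assms(3) by blast
  then have "degree (pcompose (K mod C) u) < degree (pcompose C u)"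
    using assms(2) by (simp add: degree_pcompose)
  moreover have "degree (pcompose C u) \<le> degree (pcompose C u * (s0 - pcompose d u))"
    using nz Cu by (simp add: degree_mult_eq)
  ultimately show False unfolding eq by simp
qed

text \<open>Take e(x) nonzero of least degree in the image, which contains f = D y. At a root
  \<open>l\<close> of \<open>e\<close>, \<open>descent\<close> makes a preimage of \<open>e\<close>
  congruent to a kernel element modulo \<open>x - l\<close>, so that \<open>x - l\<close> can be
  cancelled, against minimality.\<close>

lemma slice_exists: "\<exists>s. D s = 1"
proof -
  define pl where "pl n \<longleftrightarrow> (\<exists>e. e \<noteq> 0 \<and> cx e \<in> range D \<and> degree e = n)" for n
  have "pl (degree f)" unfolding pl_def using D_X2 f0 by (metis rangeI)
  then have "pl (LEAST n. pl n)" by (rule LeastI)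
  then obtain e where e: "e \<noteq> 0" "cx e \<in> range D" "degree e = (LEAST n. pl n)" unfolding pl_def by blast
  have min: "degree e \<le> degree e'" if "e' \<noteq> 0" "cx e' \<in> range D" for e'
    using that e(3) by (auto intro!: Least_le simp: pl_def)
  show ?thesis
  proof (cases "degree e = 0")
    case True
    then obtain c where c: "e = [:c:]" by (auto elim: degree_eq_zeroE)
    have "cx [:inverse c:] * cx e \<in> range D" by (rule rangeD_mult[OF e(2) D_cx])
    also have "cx [:inverse c:] * cx e = 1" using e(1) c by (simp flip: one_pCons)
    finally show ?thesis by (metis imageE)
  next
    case False
    then obtain l where "poly e l = 0" using alg_closed_imp_poly_has_root[of e] by auto
    then obtain e1 where e1: "e = [:- l, 1:] * e1" by (auto simp: poly_eq_0_iff_dvd elim: dvdE)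
    have e10: "e1 \<noteq> 0" using e(1) e1 by auto
    have dege: "degree e = 1 + degree e1" unfolding e1 using e10 by (subst degree_mult_eq) auto
    have nr: "cx e1 \<notin> range D" using min[OF e10] dege by auto
    let ?q = "cx [:- l, 1:]"
    obtain s where s: "D s = ?q * cx e1" using e(2) unfolding e1 cx_mult by auto
    \<comment> \<open>Otherwise f e1 = D (e1 y) and (x - l) e1 combine to a nonzero constant
      multiple of \<open>e1\<close> in the image.\<close>
    have fl: "poly f l = 0"
    proof (rule ccontr)
      assume fl: "poly f l \<noteq> 0"
      have "[:- l, 1:] dvd f - [:poly f l:]" by (simp add: poly_eq_0_iff_dvd[symmetric])
      then obtain f1 where "f - [:poly f l:] = [:- l, 1:] * f1" by (elim dvdE)
      then have "[:poly f l:] = f - [:- l, 1:] * f1" by (simp only: algebra_simps) 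
      then have "[:poly f l:] * e1 = (f - [:- l, 1:] * f1) * e1" by (rule arg_cong)
      then have "[:poly f l:] * e1 = e1 * f - f1 * ([:- l, 1:] * e1)" by (simp only: algebra_simps)
      then have "cx ([:poly f l:] * e1) = cx (e1 * f) - cx (f1 * ([:- l, 1:] * e1))"
        by (simp only: hom_diff[OF is_hom_cx])
      also have "\<dots> = cx e1 * D X2 - cx f1 * D s" unfolding D_X2 s cx_mult ..
      also have "\<dots> \<in> range D" by (intro rangeD_diff rangeD_mult) simp_all
      finally have "degree e \<le> degree ([:poly f l:] * e1)" using fl e10 by (intro min) auto
      then show False using dege fl by simp
    qed
    obtain c s' where c: "c \<noteq> 0" and s': "cX c * cx e1 = D s'"
      using descent[of l "cx e1"] s by (metis imageE rangeI)
    \<comment> \<open>Both terms have image (x - l) c(X) e1. Reducing the kernel element modulo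
      \<open>x - l\<close> removes \<open>s'\<close> and leaves an equation for
      \<open>s\<close>.\<close>
    have "D (?q * s' - cX c * s) = 0"
      unfolding D_simps(4) D_ker_mult[OF D_cx] D_ker_mult[OF D_cX] s s'[symmetric]
      by (simp only: mult.left_commute) simp
    then obtain H where H: "?q * s' - cX c * s = ev H" using ker_D by blast
    let ?u = "- spec2 l G"
    define C where "C = pcompose c (spec2 l F)"
    have C0: "C \<noteq> 0" unfolding C_def using pcompose_eq_0'[OF _ spec2_F] c by blast
    have u: "degree ?u > 0" by (rule deg_u[OF fl])
    have q0: "spec3 l (?q * s') = 0" by (simp only: hom_mult[OF is_hom_spec3] spec3_cx) simp
    have "spec3 l (?q * s' - cX c * s) = [:pcompose (spec2 l H) ?u:]" unfolding H by (rule spec3_ev[OF fl])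
    then have eq: "[:pcompose C ?u:] * spec3 l s = [:pcompose (- spec2 l H) ?u:]"
      unfolding hom_diff[OF is_hom_spec3] q0
      by (simp add: hom_mult[OF is_hom_spec3] cX_ev spec3_ev[OF fl] spec2_cF C_def pcompose_uminus) (metis minus_pCons minus_zero add.inverse_inverse)
    \<comment> \<open>The right side is free of z, so \<open>s\<close> modulo \<open>x - l\<close>
      lies in k[y], and by \<open>pcompose_quotient\<close> even in k[u].\<close>
    from eq have "degree ([:pcompose C ?u:] * spec3 l s) = 0" by simp
    moreover have "pcompose C ?u \<noteq> 0" using pcompose_eq_0'[OF _ u] C0 by blast
    ultimately have "degree (spec3 l s) = 0" by simp
    then obtain s0 where s0: "spec3 l s = [:s0:]" by (auto elim: degree_eq_zeroE)
    have "pcompose C ?u * s0 = pcompose (- spec2 l H) ?u" using eq by (simp add: s0 mult.commute)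
    then obtain d where d: "s0 = pcompose d ?u" using pcompose_quotient[OF _ u C0] by blast
    define d' where "d' = map_poly (\<lambda>c. [:c:]) d"
    have "spec2 l d' = d" unfolding spec2_def d'_def by (simp add: map_poly_map_poly o_def)
    then have "spec3 l (s - ev d') = 0"
      by (simp add: hom_diff[OF is_hom_spec3] s0 d spec3_ev[OF fl])
    then obtain s2 where "s - ev d' = ?q * s2" using spec3_eq_0 by blast
    then have "D (s - ev d') = ?q * D s2" by (simp only: D_ker_mult D_cx)
    then have "?q * cx e1 = ?q * D s2" by (simp only: D_simps D_ev s) simp
    then have "cx e1 = D s2" by (simp only: mult_cancel_left) simp
    then show ?thesis using nr by blast
  qed
qed

end

section \<open>Degree criteria for membership in k[x]\<close>

lemma eval3_cx: "eval3 (cx p) u v w = pcompose (map_poly (\<lambda>c. [:[:c:]:]) p) u"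
proof -
  have h: "is_hom (\<lambda>c::'a. [:[:c:]:])" by (rule is_hom_comp[OF is_hom_const is_hom_const])
  show ?thesis
  proof (rule hom_poly_eqI[of "\<lambda>p. eval3 (cx p) u v w" "\<lambda>p. pcompose (map_poly (\<lambda>c. [:[:c:]:]) p) u"])
    show "is_hom (\<lambda>p. eval3 (cx p) u v w)" by (rule is_hom_comp[OF is_hom_eval3 is_hom_cx])
    show "is_hom (\<lambda>p. pcompose (map_poly (\<lambda>c. [:[:c:]:]) p) u)"
      by (rule is_hom_comp[OF is_hom_pcompose is_hom_map_poly[OF h]])
    show "eval3 (cx [:c:]) u v w = pcompose (map_poly (\<lambda>c. [:[:c:]:]) [:c:]) u" for c
      using eval3_C3[of c u v w] by (simp add: C3_def map_poly_pCons)
    show "eval3 X1 u v w = pcompose (map_poly (\<lambda>c. [:[:c:]:]) [:0, 1:]) u"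
      by (simp add: map_poly_pCons pcompose_pCons) (simp flip: one_pCons)
  qed
qed

text \<open>Degrees multiply under composition, so \<open>U\<close> has degree 0 in both outer
  variables.\<close>

lemma X1_eq_eval3_cx:
  fixes U :: "'a::idom poly poly poly"
  assumes "X1 = eval3 (cx p) U V W"
  shows "\<exists>u. U = cx u \<and> pcompose p u = [:0, 1:]"
proof -
  have e: "pcompose (map_poly (\<lambda>c. [:[:c:]:]) p) U = X1" using assms by (simp only: eval3_cx)
  have d: "degree (map_poly (\<lambda>c. [:[:c:]:]) p) = degree p" "degree (map_poly (\<lambda>c. [:c:]) p) = degree p"
    by (simp_all add: degree_map_poly)
  have "degree p \<noteq> 0"
  proof
    assume "degree p = 0"
    then obtain c where "p = [:c:]" by (metis degree_eq_zeroE)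
    then show False using e by (simp add: map_poly_pCons)
  qed
  have "degree p * degree U = degree (X1 :: 'a poly poly poly)"
    unfolding e[symmetric] degree_pcompose d ..
  then have "degree U = 0" using \<open>degree p \<noteq> 0\<close> by simp
  then obtain U1 where U1: "U = [:U1:]" by (metis degree_eq_zeroE)
  have e1: "pcompose (map_poly (\<lambda>c. [:c:]) p) U1 = [:[:0, 1:]:]"
    using e unfolding U1 pcompose_pCons_0 by (simp add: pcompose_altdef map_poly_map_poly o_def)
  have "degree p * degree U1 = degree [:[:0::'a, 1:]:]"
    unfolding e1[symmetric] degree_pcompose d ..
  then have "degree U1 = 0" using \<open>degree p \<noteq> 0\<close> by simp
  then obtain u where u: "U1 = [:u:]" by (metis degree_eq_zeroE)
  have "pcompose p u = [:0, 1:]"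
    using e1 unfolding u pcompose_pCons_0 by (simp add: pcompose_altdef)
  then show ?thesis using U1 u by blast
qed

lemma degree_minus_const: "degree (x - [:c:]) = degree x" for x :: "'a::comm_ring_1 poly"
proof (cases "degree x = 0")
  case True
  then show ?thesis by (auto elim: degree_eq_zeroE)
next
  case False
  then show ?thesis
    using degree_add_eq_left[of "[:- c:]" x] by (simp add: diff_conv_add_uminus del: add_uminus_conv_diff)
qed

text \<open>A nonzero derivative of \<open>x\<close> has smaller degree than \<open>x - C3 l\<close>
  in the variable concerned; so the derivative vanishes, first for the outermost and then for the
  middle variable.\<close>

lemma partials_dvd_imp_cx:
  fixes x :: "'a::idom poly poly poly"
  assumes ch: "CHAR('a) = 0" and 3: "x - C3 l dvd dd3 x" and 2: "x - C3 l dvd dd2 x"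
  shows "\<exists>p. x = cx p"
proof -
  have "degree x = 0"
  proof (rule ccontr)
    assume n: "degree x \<noteq> 0"
    then have "pderiv x \<noteq> 0" using pderiv_eq_0_char0[of x] ch by auto
    then have "degree (x - C3 l) \<le> degree (pderiv x)" using 3 by (intro dvd_imp_degree_le) (simp_all add: dd3_def)
    then show False using degree_pderiv_less[OF n] by (simp add: C3_def degree_minus_const)
  qed
  then obtain x1 where x1: "x = [:x1:]" by (metis degree_eq_zeroE)
  have dv: "x1 - [:[:l:]:] dvd pderiv x1"
    using 2 unfolding x1 dd2_def C3_def by (simp add: map_poly_pCons)
  have "degree x1 = 0"
  proof (rule ccontr)
    assume n: "degree x1 \<noteq> 0"
    then have "pderiv x1 \<noteq> 0" using pderiv_eq_0_char0[of x1] ch by auto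
    then have "degree (x1 - [:[:l:]:]) \<le> degree (pderiv x1)" using dv by (intro dvd_imp_degree_le)
    then show False using degree_pderiv_less[OF n] by (simp add: degree_minus_const)
  qed
  then show ?thesis using x1 by (metis degree_eq_zeroE)
qed

lemma dvd_cx_imp_cx:
  fixes x :: "'a::idom poly poly poly"
  assumes dv: "x - C3 l dvd cx r" and "r \<noteq> 0"
  shows "\<exists>p. x = cx p"
proof -
  have "degree (x - C3 l) \<le> degree (cx r)" using assms by (intro dvd_imp_degree_le) auto
  then have "degree x = 0" by (simp add: C3_def degree_minus_const)
  then obtain x1 where x1: "x = [:x1:]" by (metis degree_eq_zeroE)
  have "x1 - [:[:l:]:] dvd [:r:]" using dv unfolding x1 C3_def by simp
  then have "degree (x1 - [:[:l:]:]) \<le> degree [:r:]" using assms by (intro dvd_imp_degree_le) auto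
  then have "degree x1 = 0" by (simp add: degree_minus_const)
  then show ?thesis using x1 by (metis degree_eq_zeroE)
qed

text \<open>Conjugation by the automorphism \<open>Phi\<close> turns \<open>dd2\<close>,
  \<open>dd3\<close> into the partials for \<open>Y\<close>, \<open>Z\<close>. The polynomial
  \<open>x\<close> expresses the first variable through \<open>X\<close>, \<open>Y\<close>,
  \<open>Z\<close>, and degrees of \<open>x\<close> settle the two divisibility assumptions.\<close>

lemma slice_if_kernel_variable_notin_cx:
  fixes f :: "'k::alg_closed_field poly" and G :: "'k poly poly"
  assumes triangular: "triangular f G" and co: "coord3 X Y Z" and DX: "triangular.D f G X = 0" and X: "X \<notin> range cx"
  shows "\<exists>s. triangular.D f G s = 1"
proof -
  interpret triangular f G by (rule triangular)
  have ch: "CHAR('k) = 0" by (rule Q_domain_char[OF Q])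
  define Phi where "Phi = (\<lambda>h. eval3 h X Y Z)"
  have hP: "is_hom Phi" unfolding Phi_def by (rule is_hom_eval3)
  have inj: "inj Phi" unfolding Phi_def by (rule coord3_inj[OF ch co])
  have sur: "surj Phi" using co unfolding Phi_def coord3_def .
  have PX: "Phi X1 = X" "Phi X2 = Y" "Phi X3 = Z" "Phi (C3 c) = C3 c" for c by (simp_all add: Phi_def)
  define d where "d = (\<lambda>dd h. Phi (dd (inv_into UNIV Phi h)))"
  have d: "d dd (Phi h) = Phi (dd h)" for dd h
    unfolding d_def inv_f_f[OF inj] ..
  have ex: "\<exists>g. h = Phi g" for h using sur by (metis surjD)
  have der: "is_derivation (d dd)" if dd: "is_derivation dd" for dd
  proof -
    have D: "der dd" "\<And>c. dd (C3 c) = 0" using dd by (auto simp: is_derivation_iff)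
    have 1: "d dd (g + h) = d dd g + d dd h" for g h
      using ex[of g] ex[of h] by (auto simp: hom_add[OF hP, symmetric] d hder_add[OF D(1)])
    have 2: "d dd (g * h) = g * d dd h + h * d dd g" for g h
      using ex[of g] ex[of h]
      by (auto simp: hom_add[OF hP, symmetric] hom_mult[OF hP, symmetric] d hder_mult[OF D(1)])
    have 3: "d dd (C3 c) = 0" for c
      using d[of dd "C3 c"] by (simp add: PX D hom_0[OF hP])
    show ?thesis unfolding is_derivation_def using 1 2 3 by blast
  qed
  obtain x where x: "Phi x = X1" using ex by metis
  have q: "cx [:- l, 1:] = Phi (x - C3 l)" for l
  proof -
    have "cx [:- l, 1:] = X1 - C3 l" by (simp add: C3_def)
    then show ?thesis by (simp only: hom_diff[OF hP] x PX)
  qed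
  have dvd: "g dvd h" if gh: "Phi g dvd Phi h" for g h
  proof -
    obtain k where k: "Phi h = Phi g * k" using gh by (elim dvdE)
    obtain k' where "k = Phi k'" using ex by blast
    then have "h = g * k'" using inj k by (simp add: hom_mult[OF hP, symmetric] inj_eq)
    then show ?thesis by simp
  qed
  \<comment> \<open>If the first variable were a polynomial in \<open>X\<close> alone, degrees would
    make \<open>X\<close> a polynomial in it.\<close>
  have fin: False if "x = cx p" for p
    using X1_eq_eval3_cx[of p X Y Z] x X unfolding that Phi_def by auto
  interpret triangular_coords f G "d dd2" "d dd3" X Y Z
  proof
    show "is_derivation (d dd2)" "is_derivation (d dd3)" by (intro der is_derivation_dd)+
    show "d dd2 (d dd3 h) = d dd3 (d dd2 h)" for h
    proof -
      have "dd2 (dd3 g) = dd3 (dd2 g)" for g :: "'k poly poly poly"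
        unfolding dd2_def dd3_def
        by (rule poly_eqI) (simp add: coeff_map_poly coeff_pderiv pderiv_smult of_nat_poly)
      then show ?thesis using ex[of h] by (auto simp: d)
    qed
    show "\<exists>h'. d dd2 h' = h" for h
    proof -
      obtain g where "h = Phi g" using ex by blast
      moreover obtain k where "dd2 k = g" using dd_surj(2)[OF Q] by blast
      ultimately show ?thesis using d by metis
    qed
    show "d dd2 X = 0" "d dd3 X = 0" "d dd2 Y = 1" "d dd3 Y = 0" "d dd2 Z = 0" "d dd3 Z = 1"
      unfolding PX[symmetric] d by (simp_all add: hom_0[OF hP] hom_1[OF hP])
    show "D h = D Y * d dd2 h + D Z * d dd3 h" for h
    proof -
      obtain g where g: "h = Phi g" using ex by blast
      have "D h = eval3 (dd1 g) X Y Z * D X + eval3 (dd2 g) X Y Z * D Y + eval3 (dd3 g) X Y Z * D Z"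
        unfolding g Phi_def by (rule derivation_eval3[OF is_derivation_D])
      then show ?thesis unfolding g d using DX by (simp add: Phi_def mult.commute)
    qed
    show "X \<notin> range cx" by (rule X)
    show "X \<in> range cx" if "cx [:- l, 1:] dvd d dd2 X1" "cx [:- l, 1:] dvd d dd3 X1" for l
    proof -
      have d1: "d dd X1 = Phi (dd x)" for dd using d[of dd x] unfolding x .
      have "x - C3 l dvd dd2 x" "x - C3 l dvd dd3 x"
        using that unfolding q d1 by (blast intro: dvd)+
      then have "\<exists>p. x = cx p" by (intro partials_dvd_imp_cx[OF ch])
      then show ?thesis using fin by blast
    qed
    show "X \<in> range cx" if "cx [:- l, 1:] dvd X - C3 nu" for l nu
    proof -
      have "cx [:- nu, 1:] = X1 - C3 nu" by (simp add: C3_def)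
      then have e: "X - C3 nu = Phi (cx [:- nu, 1:])" by (simp only: PX hom_diff[OF hP])
      have "Phi (x - C3 l) dvd Phi (cx [:- nu, 1:])" using that unfolding e q[of l] .
      then have "x - C3 l dvd cx [:- nu, 1:]" by (rule dvd)
      then have "\<exists>p. x = cx p" by (rule dvd_cx_imp_cx) simp
      then show ?thesis using fin by blast
    qed
  qed
  show ?thesis by (rule slice_exists)
qed

section \<open>Descent to the base field\<close>

text \<open>The vector 1 is linearly independent over the smaller field, so its value under a linear
  map can be prescribed.\<close>

lemma ex_retraction:
  fixes j :: "'k::field \<Rightarrow> 'e::field"
  assumes j: "is_hom j"
  shows "\<exists>r. (\<forall>x y. r (x + y) = r x + r y) \<and> (\<forall>c x. r (j c * x) = c * r x) \<and> r 1 = 1"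
proof -
  interpret vector_space_pair "\<lambda>c x. j c * x" "(*) :: 'k \<Rightarrow> 'k \<Rightarrow> 'k"
    by unfold_locales (simp_all add: hom_simps[OF j] algebra_simps)
  have "vs1.independent {1}" by simp
  from linear_independent_extend[OF this, of "\<lambda>_. 1"] obtain r where
    r: "Vector_Spaces.linear (\<lambda>c x. j c * x) (*) r" "r 1 = 1" by auto
  interpret r: Vector_Spaces.linear "\<lambda>c x. j c * x" "(*)" r by (rule r)
  show ?thesis using r.add r.scale r(2) by blast
qed

definition retr :: "('a::comm_ring_1 \<Rightarrow> 'b::comm_ring_1) \<Rightarrow> ('b \<Rightarrow> 'a) \<Rightarrow> bool" where
  "retr j r \<longleftrightarrow> is_hom j \<and> (\<forall>x y. r (x + y) = r x + r y) \<and> (\<forall>c x. r (j c * x) = c * r x) \<and> r 1 = 1"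

lemma retrD:
  assumes "retr j r"
  shows "is_hom j" "r (x + y) = r x + r y" "r (j c * x) = c * r x" "r 0 = 0" "r 1 = 1" "r (j c) = c"
proof -
  show a: "is_hom j" "r (x + y) = r x + r y" "r (j c * x) = c * r x" "r 1 = 1"
    for x y c using assms unfolding retr_def by auto
  show "r 0 = 0" using a(2)[of 0 0] by simp
  show "r (j c) = c" using a(3)[of c 1] a(4) by simp
qed

lemma retr_map_poly:
  assumes "retr j r"
  shows "retr (map_poly j) (map_poly r)"
proof -
  note R = retrD[OF assms]
  have ad: "map_poly r (p + q) = map_poly r p + map_poly r q" for p q
    by (rule map_poly_add') (rule R)
  have pc: "map_poly r (pCons a p) = pCons (r a) (map_poly r p)" for a p
    by (simp add: map_poly_pCons R)
  have sm: "map_poly r (smult (j a) q) = smult a (map_poly r q)" for a q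
    by (rule poly_eqI) (simp add: coeff_map_poly R)
  have "map_poly r (map_poly j p * q) = p * map_poly r q" for p q
    by (induction p) (simp_all add: R(1) ad pc sm R(4))
  then show ?thesis
    unfolding retr_def using is_hom_map_poly[OF R(1)] ad by (simp add: R(5))
qed

lemma retr_map3: "retr j r \<Longrightarrow> retr (map3 j) (map3 r)"
  unfolding map3_def by (intro retr_map_poly)

text \<open>A retraction need not be multiplicative, so \<open>hom_poly_eqI\<close> is replaced by
  additivity and compatibility with the variable.\<close>

lemma additive_poly_eqI:
  fixes g h :: "'a::comm_ring_1 poly \<Rightarrow> 'b::comm_ring_1"
  assumes "\<And>p q. g (p + q) = g p + g q" "\<And>p q. h (p + q) = h p + h q"
    and "\<And>p. g ([:0, 1:] * p) = t * g p" "\<And>p. h ([:0, 1:] * p) = t * h p"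
    and "\<And>c. g [:c:] = h [:c:]"
  shows "g p = h p"
proof (induction p)
  case 0
  then show ?case using assms(1)[of 0 0] assms(2)[of 0 0] by simp
next
  case (pCons a p)
  then show ?case by (simp only: pCons_conv[of a p] assms)
qed

lemma retr_eval3:
  assumes "retr j r"
  shows "map3 r (eval3 H (map3 j u) (map3 j v) (map3 j w)) = eval3 (map3 r H) u v w"
proof -
  note R = retrD[OF retr_map3[OF assms]]
  note R0 = retrD[OF assms]
  let ?E = "\<lambda>H. eval3 H (map3 j u) (map3 j v) (map3 j w)"
  have X: "map3 r (X1 * p) = X1 * map3 r p" "map3 r (X2 * p) = X2 * map3 r p" "map3 r (X3 * p) = X3 * map3 r p" for p
    using R(3)[of X1 p] R(3)[of X2 p] R(3)[of X3 p] by (simp_all only: map3_basic[OF R0(1)])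
  have ad: "map3 r (?E (p + q)) = map3 r (?E p) + map3 r (?E q)"
       "eval3 (map3 r (p + q)) u v w = eval3 (map3 r p) u v w + eval3 (map3 r q) u v w" for p q
    by (simp_all only: eval3_simps R(2))
  have mu: "map3 r (?E (X1 * p)) = u * map3 r (?E p)" "eval3 (map3 r (X1 * p)) u v w = u * eval3 (map3 r p) u v w"
    "map3 r (?E (X2 * p)) = v * map3 r (?E p)" "eval3 (map3 r (X2 * p)) u v w = v * eval3 (map3 r p) u v w"
    "map3 r (?E (X3 * p)) = w * map3 r (?E p)" "eval3 (map3 r (X3 * p)) u v w = w * eval3 (map3 r p) u v w" for p
    by (simp_all only: eval3_simps eval3_X1 eval3_X2 eval3_X3 R(3) X)
  have cc: "[:c + d:] = [:c:] + [:d:]" "[:c * d:] = [:c:] * [:d:]" for c d :: "'c::comm_ring_1" by simp_all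
  have c0: "map3 r (?E (C3 c)) = eval3 (map3 r (C3 c)) u v w" for c
  proof -
    have "map3 r (C3 c) = C3 (r c)"
      by (simp add: map3_def C3_def map_poly_pCons R0)
    then show ?thesis by simp
  qed
  have c1: "map3 r (?E (cx p)) = eval3 (map3 r (cx p)) u v w" for p
    by (rule additive_poly_eqI[where t = u]) (simp_all only: cc ad mu C3_def[symmetric] c0)
  have c2: "map3 r (?E [:p:]) = eval3 (map3 r [:p:]) u v w" for p
    by (rule additive_poly_eqI[where t = v]) (simp_all only: cc ad mu c1)
  show ?thesis
    by (rule additive_poly_eqI[where t = w]) (simp_all only: ad mu c2)
qed

text \<open>Express the image of \<open>b\<close> through the coordinates over the larger ring and
  retract the coefficients.\<close>

lemma retr_coord3:
  assumes r: "retr j r" and co: "coord3 (map3 j u) (map3 j v) (map3 j w)"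
  shows "coord3 u v w"
proof -
  have "\<exists>a. b = eval3 a u v w" for b
  proof -
    obtain H where H: "eval3 H (map3 j u) (map3 j v) (map3 j w) = map3 j b"
      using coord3_ex[OF co] by blast
    have "b = eval3 (map3 r H) u v w"
      unfolding retr_eval3[OF r, symmetric] H by (rule retrD(6)[OF retr_map3[OF r], symmetric])
    then show ?thesis by blast
  qed
  then show ?thesis unfolding coord3_def by auto
qed

section \<open>Coefficient maps, derivatives and degrees\<close>

lemma map_poly_commute_pderiv:
  fixes h :: "'a::idom \<Rightarrow> 'b::idom"
  assumes "\<And>x y. h (x + y) = h x + h y"
  shows "map_poly h (pderiv p) = pderiv (map_poly h p)"
proof -
  have h0: "h 0 = 0" using assms[of 0 0] by (metis add.right_neutral add_left_cancel)
  have "h (of_nat n * x) = of_nat n * h x" for n x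
    by (induction n) (simp_all add: h0 assms algebra_simps)
  then show ?thesis by (intro poly_eqI) (simp add: coeff_map_poly h0 coeff_pderiv del: of_nat_Suc)
qed

text \<open>Stated for additive maps so as to cover retractions besides homomorphisms.\<close>

lemma map3_dd:
  fixes h :: "'a::idom \<Rightarrow> 'b::idom"
  assumes h: "\<And>x y. h (x + y) = h x + h y"
  shows "map3 h (dd1 p) = dd1 (map3 h p)" "map3 h (dd2 p) = dd2 (map3 h p)" "map3 h (dd3 p) = dd3 (map3 h p)"
proof -
    have h1: "map_poly h (p + q) = map_poly h p + map_poly h q" for p q by (rule map_poly_add'[OF h])
  have h2: "map_poly (map_poly h) (p + q) = map_poly (map_poly h) p + map_poly (map_poly h) q" for p q
    by (rule map_poly_add'[OF h1])
  show "map3 h (dd3 p) = dd3 (map3 h p)"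
    unfolding map3_def dd3_def by (rule map_poly_commute_pderiv[OF h2])
  show "map3 h (dd2 p) = dd2 (map3 h p)"
    unfolding map3_def dd2_def
    by (simp add: map_poly_map_poly o_def map_poly_commute_pderiv[OF h1])
  show "map3 h (dd1 p) = dd1 (map3 h p)"
    unfolding map3_def dd1_def
    by (simp add: map_poly_map_poly o_def map_poly_commute_pderiv[OF h])
qed

lemma map3_in_range_cx:
  assumes h: "is_hom h" "inj h" and r: "map3 h U \<in> range cx"
  shows "U \<in> range cx"
proof -
  have z: "h x = 0 \<longleftrightarrow> x = 0" for x using h by (metis hom_0 injD)
  have mz: "map_poly k p = 0 \<longleftrightarrow> p = 0" if "\<And>x. k x = 0 \<longleftrightarrow> x = 0" for k :: "'c::zero \<Rightarrow> 'd::zero" and p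
    by (rule map_poly_eq_0_iff) (use that in auto)
  obtain p where p: "map3 h U = cx p" using r by blast
  have dm: "degree (map_poly k q) = degree q" if "\<And>x. k x = 0 \<longleftrightarrow> x = 0" for k :: "'c::zero \<Rightarrow> 'd::zero" and q
    by (rule degree_map_poly) (use that in auto)
  have "degree U = 0"
    using arg_cong[OF p, of degree] unfolding map3_def by (subst (asm) dm) (simp_all add: mz z)
  then obtain U1 where U1: "U = [:U1:]" by (metis degree_eq_zeroE)
  have "map_poly (map_poly h) U1 = [:p:]"
    using p by (simp add: U1 map3_def is_hom_map_poly h)
  from arg_cong[OF this, of degree] have "degree U1 = 0"
    by (subst (asm) dm) (simp_all add: mz z)
  then obtain u where "U1 = [:u:]" by (metis degree_eq_zeroE)
  then show ?thesis using U1 by blast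
qed

text \<open>The ideal generated by \<open>f\<close> and the coefficients of \<open>g\<close> is described through the
  ideals containing it; a nonzero element of least degree generates it.\<close>
lemma remove_common_factor:
  fixes f :: "'k::field poly" and g :: "'k poly poly" and j :: "'k \<Rightarrow> 'e::idom"
  assumes f0: "f \<noteq> 0" and j: "is_hom j"
  shows "\<exists>d f0 g0. d \<noteq> 0 \<and> f = d * f0 \<and> g = [:d:] * g0 \<and>
    (\<forall>l. poly (map_poly j f0) l = 0 \<longrightarrow> (\<exists>n. poly (map_poly j (coeff g0 n)) l \<noteq> 0))"
proof -
  define ideal where "ideal S \<longleftrightarrow> (\<forall>p q. p \<in> S \<longrightarrow> q \<in> S \<longrightarrow> p + q \<in> S) \<and> (\<forall>p q. q \<in> S \<longrightarrow> p * q \<in> S)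
     \<and> f \<in> S \<and> (\<forall>n. coeff g n \<in> S)" for S :: "'k poly set"
  define I where "I = \<Inter>{S. ideal S}"
  have I: "ideal I" unfolding I_def ideal_def by blast
  define n where "n = (LEAST n. \<exists>d \<in> I. d \<noteq> 0 \<and> degree d = n)"
  have "\<exists>d \<in> I. d \<noteq> 0 \<and> degree d = n"
    unfolding n_def by (rule LeastI_ex) (use I f0 ideal_def in blast)
  then obtain d where d: "d \<in> I" "d \<noteq> 0" "degree d = n" by blast
  have min: "n \<le> degree e" if "e \<in> I" "e \<noteq> 0" for e
    unfolding n_def by (rule Least_le) (use that in blast)
  have dvd: "d dvd p" if p: "p \<in> I" for p
  proof -
    have eq: "p mod d = p + (- (p div d)) * d" by (simp add: minus_div_mult_eq_mod[symmetric])
    have "(- (p div d)) * d \<in> I" using I d(1) unfolding ideal_def by blast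
    then have "p mod d \<in> I" unfolding eq using I p unfolding ideal_def by blast
    then have "p mod d = 0" using min[of "p mod d"] degree_mod_less[OF d(2), of p] d(3) by (cases "p mod d = 0") auto
    then show ?thesis by (simp add: mod_eq_0_iff_dvd)
  qed
  have "d dvd f" "[:d:] dvd g"
    using dvd I unfolding ideal_def const_poly_dvd_iff by blast+
  then obtain f0 g0 where fg: "f = d * f0" "g = [:d:] * g0" unfolding dvd_def by blast
  have "\<exists>n. poly (map_poly j (coeff g0 n)) l \<noteq> 0" if fl: "poly (map_poly j f0) l = 0" for l
  proof (rule ccontr)
    assume no: "\<nexists>n. poly (map_poly j (coeff g0 n)) l \<noteq> 0"
    define e where "e = (\<lambda>p. poly (map_poly j p) l)"
    have e: "is_hom e" unfolding e_def by (rule is_hom_eval[OF j])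
    \<comment> \<open>With a common root \<open>l\<close>, the multiples of \<open>d\<close> by
      polynomials vanishing at \<open>l\<close> would form an ideal containing \<open>f\<close> and
      the coefficients of \<open>g\<close>, hence \<open>d\<close>; so 1 would vanish at
      \<open>l\<close>.\<close>
    define S where "S = {d * p |p. e p = 0}"
    have "ideal S"
      unfolding ideal_def
    proof (intro conjI allI impI)
      fix p q assume "p \<in> S" "q \<in> S"
      then obtain p0 q0 where "p = d * p0" "q = d * q0" "e p0 = 0" "e q0 = 0" unfolding S_def by blast
      then have "p + q = d * (p0 + q0)" "e (p0 + q0) = 0" by (simp_all add: distrib_left hom_add[OF e])
      then show "p + q \<in> S" unfolding S_def by blast
    next
      fix p q assume "q \<in> S"
      then obtain q0 where "q = d * q0" "e q0 = 0" unfolding S_def by blast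
      then have "p * q = d * (p * q0)" "e (p * q0) = 0" by (simp_all add: mult.left_commute hom_mult[OF e])
      then show "p * q \<in> S" unfolding S_def by blast
    next
      show "f \<in> S" using fl fg unfolding S_def e_def by blast
      show "coeff g n \<in> S" for n using no fg unfolding S_def e_def by auto
    qed
    then have "d \<in> S" using d(1) unfolding I_def by blast
    then obtain p where "d = d * p" "e p = 0" unfolding S_def by blast
    then have "p = 1" using d(2) by (metis mult_cancel_left mult.right_neutral)
    then show False using \<open>e p = 0\<close> hom_1[OF e] by simp
  qed
  then show ?thesis using d(2) fg by blast
qed

lemma is_hom_to_ac: "is_hom (to_ac :: 'k::field \<Rightarrow> _)"
  by (simp add: is_hom_def)

text \<open>Over the algebraic closure the reduced derivation has a slice; it descends along a
  linear retraction of the closure onto the base field.\<close>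
lemma kernel_coordinate_or_rank_le_one:
  fixes f :: "'k::field poly" and g :: "'k poly poly"
  assumes ch: "CHAR('k) = 0" and f0: "f \<noteq> 0" and co: "coord3 X Y Z"
    and DX: "cx f * dd2 X + [:g:] * dd3 X = 0" and X: "X \<notin> range cx"
  shows "\<exists>P s. coord3 X1 P s \<and> cx f * dd2 P + [:g:] * dd3 P = 0"
proof -
  let ?j = "to_ac :: 'k \<Rightarrow> 'k alg_closure"
  have j: "is_hom ?j" by (rule is_hom_to_ac)
  have j_inj: "inj ?j" by (rule inj_to_ac)
  obtain r where r: "retr ?j r" using ex_retraction[OF j] j unfolding retr_def by blast
  note R = retrD[OF r]
  note R3 = retrD[OF retr_map3[OF r]]
  obtain d f' g' where d: "d \<noteq> 0" and f: "f = d * f'" and g: "g = [:d:] * g'"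
    and nc: "\<And>l. poly (map_poly ?j f') l = 0 \<Longrightarrow> \<exists>n. poly (map_poly ?j (coeff g' n)) l \<noteq> 0"
    using remove_common_factor[OF f0 j, of g] by blast
  have fg: "cx f * dd2 h + [:g:] * dd3 h = cx d * (cx f' * dd2 h + [:g':] * dd3 h)" for h
  proof -
    have "[:g:] = cx d * [:g':]" unfolding g by simp
    then show ?thesis unfolding f cx_mult by (simp only: distrib_left mult.assoc)
  qed
  obtain G where G: "pderiv G = g'" using pderiv_surj[OF Q_domain_poly[OF Q_domain_field[OF ch]]] by blast
  let ?f = "map_poly ?j f'" and ?G = "map_poly (map_poly ?j) G"
  have pG: "pderiv ?G = map_poly (map_poly ?j) g'"
    unfolding G[symmetric] by (rule map_poly_commute_pderiv[symmetric]) (simp add: hom_add[OF is_hom_map_poly[OF j]])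
  have chE: "CHAR('k alg_closure) = 0" using ch by simp
  have triangular: "triangular ?f ?G"
  proof
    show "Q_domain TYPE('k alg_closure)" by (rule Q_domain_field[OF chE])
    have "f' \<noteq> 0" using f0 f by auto
    then show "?f \<noteq> 0" by (metis R(4) R(6) coeff_map_poly hom_0[OF j] leading_coeff_0_iff coeff_0)
    show "pderiv (spec2 l ?G) \<noteq> 0" if l: "poly ?f l = 0" for l
    proof
      assume z: "pderiv (spec2 l ?G) = 0"
      have "coeff (spec2 l (pderiv ?G)) n = poly (map_poly ?j (coeff g' n)) l" for n
        unfolding pG spec2_def by (simp add: coeff_map_poly)
      then show False using nc[OF l] z by (simp add: spec2_pderiv)
    qed
  qed
  interpret triangular ?f ?G by (rule triangular)
  have DE: "D (map3 ?j h) = map3 ?j (cx f' * dd2 h + [:g':] * dd3 h)" for h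
  proof -
    have "map3 ?j (cx f') = cx ?f" "map3 ?j [:g':] = [:pderiv ?G:]"
      unfolding pG by (simp_all add: map3_def is_hom_map_poly j)
    then show ?thesis
      unfolding D_def by (simp only: hom_add[OF R3(1)] hom_mult[OF R3(1)] map3_dd[OF hom_add[OF j]])
  qed
  have "cx d * (cx f' * dd2 X + [:g':] * dd3 X) = 0" using DX unfolding fg .
  then have "cx f' * dd2 X + [:g':] * dd3 X = 0" using d by simp
  then have "D (map3 ?j X) = 0" unfolding DE by (simp add: hom_0[OF R3(1)])
  then obtain sE where sE: "D sE = 1"
    using slice_if_kernel_variable_notin_cx[OF triangular coord3_map3[OF j co]] map3_in_range_cx[OF j j_inj, of X] X by blast
  \<comment> \<open>The retraction of a slice is a slice, since \<open>f'\<close> and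
    \<open>g'\<close> are defined over the base field and the retraction commutes with the
    partials.\<close>
  define s where "s = map3 r sE"
  have "map3 ?j (cx f') = cx ?f" "map3 ?j [:g':] = [:pderiv ?G:]"
    unfolding pG by (simp_all add: map3_def is_hom_map_poly j)
  then have "map3 ?j (cx f') * dd2 sE + map3 ?j [:g':] * dd3 sE = 1" using sE unfolding D_def by simp
  then have "map3 r (map3 ?j (cx f') * dd2 sE + map3 ?j [:g':] * dd3 sE) = 1" by (simp only: R3(5))
  then have "cx f' * dd2 s + [:g':] * dd3 s = 1"
    unfolding s_def by (simp only: R3(2,3) map3_dd[OF R(2)])
  then have "D (map3 ?j s) = 1" unfolding DE by (simp only: hom_1[OF R3(1)])
  then have "coord3 X1 P (map3 ?j s)" by (rule slice_coord3)
  moreover define P0 where "P0 = [:- G, [:f':]:]"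
  moreover have "P = map3 ?j P0"
    unfolding P_def P0_def by (simp add: map3_def is_hom_map_poly j hom_uminus[OF is_hom_map_poly[OF is_hom_map_poly[OF j]]])
  ultimately have "coord3 (map3 ?j X1) (map3 ?j P0) (map3 ?j s)" using j by simp
  then have "coord3 X1 P0 s" by (rule retr_coord3[OF r])
  moreover have "cx f' * dd2 P0 + [:g':] * dd3 P0 = 0"
    unfolding P0_def dd2_def dd3_def by (simp add: map_poly_pCons pderiv_pCons pderiv_minus G mult.commute)
  then have "cx f * dd2 P0 + [:g:] * dd3 P0 = 0" unfolding fg by simp
  ultimately show ?thesis by blast
qed

section \<open>The equivalence\<close>

lemma eval3_const3: "eval3 [:a:] u v w = eval3 [:a:] u v w'"
  by (simp add: eval3_def map_poly_hom_pCons is_hom_eval is_hom_C3)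

lemma eval3_const2: "eval3 (cx p) u v w = eval3 (cx p) u v' w'"
  by (simp add: eval3_cx)

text \<open>Trades padding by zeros for a polynomial in fewer variables, whose remaining argument is
  then arbitrary.\<close>

lemma eval3_last_0: "\<exists>a. \<forall>u v w. eval3 h u v 0 = eval3 [:a:] u v w"
proof -
  obtain a h' where "h = pCons a h'" by (rule pCons_cases)
  then have "eval3 h u v 0 = eval3 [:a:] u v w" for u v w
    using eval3_const3[of a u v 0 w]
    by (simp only: pCons_conv[of a h'] eval3_simps(3,4) eval3_X3) simp
  then show ?thesis by blast
qed

lemma eval3_last2_0: "\<exists>p. \<forall>u v w. eval3 h u 0 0 = eval3 (cx p) u v w"
proof -
  obtain a where a: "\<And>u v w. eval3 h u v 0 = eval3 [:a:] u v w" using eval3_last_0 by blast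
  obtain p a' where "a = pCons p a'" by (rule pCons_cases)
  then have e: "[:a:] = cx p + X2 * [:a':]" by simp
  have "eval3 h u 0 0 = eval3 (cx p) u v w" for u v w
    unfolding a[of u 0 0] e using eval3_const2[of p u 0 0 v w]
    by (simp only: eval3_simps(3,4) eval3_X2) simp
  then show ?thesis by blast
qed

section \<open>The fraction field and bounds on the rank\<close>

lemma is_hom_Fract: "is_hom (\<lambda>a. Fract a 1)"
  by (simp add: is_hom_def One_fract_def)

lemma inj_Fract: "inj (\<lambda>a. Fract a 1)"
  by (rule injI) (simp add: eq_fract)

lemma CHAR_fract:
  assumes "CHAR('a::idom) = 0"
  shows "CHAR('a fract) = 0"
proof -
  have "(of_nat n :: 'a fract) \<noteq> 0" if "n > 0" for n
    using assms that by (simp add: of_nat_fract Zero_fract_def eq_fract CHAR_eq0_iff)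
  then show ?thesis by (simp add: CHAR_eq0_iff)
qed

lemma embK_eq: "embK = map3 (\<lambda>a. Fract a 1)"
  by (rule ext) (simp add: embK_def map3_def)

text \<open>The extension is built from the values of \<open>D\<close> on the variables, and these
  values determine it; so the description by \<open>THE\<close> is meaningful.\<close>

lemma extK:
  assumes D: "is_derivation D"
  shows "is_derivation (extK D)" "extK D (embK h) = embK (D h)"
proof -
  note h = is_hom_Fract
  note h3 = is_hom_map3[OF h]
  define E where "E = (\<lambda>h. dd1 h * embK (D X1) + dd2 h * embK (D X2) + dd3 h * embK (D X3))"
  have E: "is_derivation E" unfolding E_def by (rule is_derivation_lin3)
  have Eh: "E (embK h) = embK (D h)" for h
    unfolding derivation_formula[OF D, of h] E_def embK_eq
    by (simp only: hom_add[OF h3] hom_mult[OF h3] map3_dd[OF hom_add[OF h]])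
  have "D' = E" if D': "is_derivation D' \<and> (\<forall>f. D' (embK f) = embK (D f))" for D'
  proof
    fix g
    have "D' X1 = embK (D X1)" "D' X2 = embK (D X2)" "D' X3 = embK (D X3)"
      using D' map3_basic(2-4)[OF h] by (metis embK_eq)+
    then show "D' g = E g" unfolding E_def using derivation_formula[of D' g] D' by simp
  qed
  then have "extK D = E" unfolding extK_def using E Eh by (intro the_equality) auto
  then show "is_derivation (extK D)" "extK D (embK h) = embK (D h)" using E Eh by auto
qed

lemma rank3_le_1:
  fixes D :: "'a::idom poly poly poly \<Rightarrow> 'a poly poly poly"
  assumes D: "is_derivation D" and co: "coord3 u v w" and "D u = 0" "D v = 0"
  shows "rank3 D \<le> 1"
proof -
  have "D 0 = 0" using D hder_0[of "\<lambda>x. x" D] by (simp add: is_derivation_iff)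
  then have "D (eval3 f u v 0) = 0" for f
    unfolding derivation_eval3[OF D] using assms by simp
  then show ?thesis
    unfolding rank3_def by (intro Least_le exI[of _ u] exI[of _ v] exI[of _ w]) (simp add: co)
qed

lemma coord3_eval3:
  assumes "coord3 u v w" "coord3 y1 y2 y3"
  shows "coord3 (eval3 u y1 y2 y3) (eval3 v y1 y2 y3) (eval3 w y1 y2 y3)"
proof -
  have "\<exists>c. b = eval3 c (eval3 u y1 y2 y3) (eval3 v y1 y2 y3) (eval3 w y1 y2 y3)" for b
  proof -
    obtain a where a: "eval3 a y1 y2 y3 = b" using coord3_ex[OF assms(2)] by blast
    obtain c where "eval3 c u v w = a" using coord3_ex[OF assms(1)] by blast
    then show ?thesis using a eval3_eval3[of c u v w y1 y2 y3] by metis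
  qed
  then show ?thesis unfolding coord3_def by auto
qed

lemma coord3_replace_first:
  assumes "coord3 y1 y2 y3" "y1 = eval3 e x y2 y3"
  shows "coord3 x y2 y3"
proof -
  have "\<exists>c. b = eval3 c x y2 y3" for b
  proof -
    obtain a where "eval3 a y1 y2 y3 = b" using coord3_ex[OF assms(1)] by blast
    then have "b = eval3 (eval3 a e X2 X3) x y2 y3" using assms(2) by (simp add: eval3_eval3)
    then show ?thesis by blast
  qed
  then show ?thesis unfolding coord3_def by auto
qed

text \<open>Up to the constant \<open>al\<close>, x is a slice: integrating in x corrects y and z to
  kernel elements, which together with x form a coordinate system.\<close>

lemma rank_le_one_of_slice_x:
  fixes al :: "'k::field" and f :: "'k poly" and g :: "'k poly poly"
  assumes ch: "CHAR('k) = 0" and al: "al \<noteq> 0"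
    and D: "is_derivation D" "D X1 = C3 al" "D X2 = cx f" "D X3 = [:g:]"
  shows "\<exists>u v w. coord3 u v w \<and> D u = 0 \<and> D v = 0"
proof -
  have Q: "Q_domain TYPE('k)" by (rule Q_domain_field[OF ch])
  have dD: "der D" using D by (simp add: is_derivation_iff)
  obtain p where p: "pderiv p = smult (inverse al) f" using pderiv_surj[OF Q] by blast
  have ap: "cx (pderiv p) * C3 al = cx f" using al unfolding p C3_def by simp
  define u where "u = X2 - cx p"
  have Dcx: "D (cx p) = cx f"
    using derivation_formula[OF D(1), of "cx p"] ap unfolding D
    by (simp add: dd1_def dd2_def dd3_def map_poly_pCons)
  have Du: "D u = 0" unfolding u_def hder_diff[OF dD] D Dcx by simp
  have D0: "D 0 = 0" by (rule hder_0[OF dD])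
  \<comment> \<open>This is \<open>g\<close> rewritten through y = u + p(x), so that integration in
    x treats the kernel element \<open>u\<close> as a constant.\<close>
  define g' where "g' = eval3 [:g:] X1 (X2 + cx p) 0"
  have g': "eval3 g' X1 u 0 = [:g:]"
  proof -
    have c: "eval3 (cx p) X1 u 0 = cx p"
      using eval3_const2[of p X1 u 0 X2 X3] by simp
    have "eval3 g' X1 u 0 = eval3 [:g:] X1 X2 0"
      unfolding g'_def eval3_eval3 by (simp only: eval3_simps c eval3_X1 eval3_X2) (simp add: u_def)
    also have "\<dots> = [:g:]" using eval3_const3[of g X1 X2 0 X3] by simp
    finally show ?thesis .
  qed
  obtain H where H: "dd1 H = C3 (inverse al) * g'" using dd_surj(1)[OF Q] by blast
  define v where "v = X3 - eval3 H X1 u 0"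
  have "D (eval3 H X1 u 0) = [:g:]"
    unfolding derivation_eval3[OF D(1)] D Du D0 H
    using al by (simp only: eval3_simps g' eval3_C3) (simp add: C3_def, simp flip: one_pCons)
  then have Dv: "D v = 0" unfolding v_def hder_diff[OF dD] D by simp
  have "coord3 u v X1"
  proof (rule coord3I)
    show "eval3 X3 u v X1 = X1" by simp
    show "eval3 (X1 + eval3 (cx p) X3 0 0) u v X1 = X2"
      using eval3_const2[of p X1 0 0 X2 X3] by (simp only: eval3_simps eval3_eval3 eval3_X1 eval3_X3) (simp add: u_def)
    show "eval3 (X2 + eval3 H X3 X1 0) u v X1 = X3"
      by (simp only: eval3_simps eval3_eval3 eval3_X1 eval3_X2 eval3_X3) (simp add: v_def)
  qed
  then show ?thesis using Du Dv by blast
qed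

theorem theorem1p3:
  fixes D :: "'a::idom poly poly poly \<Rightarrow> 'a poly poly poly"
    and X Y Z :: "'a poly poly poly"
  assumes "Q_domain TYPE('a)"
    and "is_LND D"
    and "coord3 X Y Z"
    and "D X = 0"
    and "rank3 D = 2"
    and "rank3 (extK D) = 2"
  shows "triangulable_A D \<longleftrightarrow> triangulable_over_var D X"
proof
  assume "triangulable_over_var D X"
  then obtain y1 y2 where "coord3 X y1 y2" "\<exists>f. D y1 = eval3 f X 0 0" "\<exists>f. D y2 = eval3 f X y1 0"
    unfolding triangulable_over_var_def coord3_def by blast
  moreover have "D X = C3 0" using assms(4) by (simp add: hom_0[OF is_hom_C3])
  ultimately show "triangulable_A D" unfolding triangulable_A_def by blast
next
  assume "triangulable_A D"
  then obtain y1 y2 y3 a F1 F2 where co: "coord3 y1 y2 y3" and Dy1: "D y1 = C3 a"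
    and Dy2: "D y2 = eval3 F1 y1 0 0" and Dy3: "D y3 = eval3 F2 y1 y2 0"
    unfolding triangulable_A_def by blast
  have D: "is_derivation D" using assms(2) by (simp add: is_LND_def)
  have ch: "CHAR('a) = 0" by (rule Q_domain_char[OF assms(1)])
  have chK: "CHAR('a fract) = 0" by (rule CHAR_fract[OF ch])
  obtain f where f: "\<And>u v w. eval3 F1 u 0 0 = eval3 (cx f) u v w" using eval3_last2_0 by blast
  obtain g where g: "\<And>u v w. eval3 F2 u v 0 = eval3 [:g:] u v w" using eval3_last_0 by blast
  define Psi where "Psi = (\<lambda>h. eval3 h y1 y2 y3)"
  have inj: "inj Psi" unfolding Psi_def by (rule coord3_inj[OF ch co])
  have hP: "is_hom Psi" unfolding Psi_def by (rule is_hom_eval3)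
  have ex: "\<exists>h. Psi h = b" for b unfolding Psi_def by (rule coord3_ex[OF co])

  let ?j = "\<lambda>a::'a. Fract a 1"
  note j = is_hom_Fract[where 'a = 'a]
  note j3 = is_hom_map3[OF j]
  define DK where "DK = extK D"
  have DK: "is_derivation DK" "\<And>h. DK (map3 ?j h) = map3 ?j (D h)"
    unfolding DK_def using extK[OF D] by (simp_all add: embK_eq)
  have coK: "coord3 (map3 ?j y1) (map3 ?j y2) (map3 ?j y3)" by (rule coord3_map3[OF j co])
  define PsiK where "PsiK = (\<lambda>h. eval3 h (map3 ?j y1) (map3 ?j y2) (map3 ?j y3))"
  let ?fK = "map_poly ?j f" and ?gK = "map_poly (map_poly ?j) g"
  have jf: "map3 ?j (cx f) = cx ?fK" "map3 ?j [:g:] = [:?gK:]"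
    by (simp_all add: map3_def is_hom_map_poly j)
  have DPsiK: "DK (PsiK h) = PsiK (C3 (?j a) * dd1 h + cx ?fK * dd2 h + [:?gK:] * dd3 h)" for h
  proof -
    have "DK (map3 ?j y1) = PsiK (C3 (?j a))"
      unfolding DK Dy1 PsiK_def by (simp add: j)
    moreover have "DK (map3 ?j y2) = PsiK (cx ?fK)"
      unfolding DK Dy2 f[of y1 y2 y3] PsiK_def jf[symmetric] by (rule map3_eval3[OF j])
    moreover have "DK (map3 ?j y3) = PsiK [:?gK:]"
      unfolding DK Dy3 g[of y1 y2 y3] PsiK_def jf[symmetric] by (rule map3_eval3[OF j])
    moreover have "DK (PsiK h) = PsiK (dd1 h) * DK (map3 ?j y1) + PsiK (dd2 h) * DK (map3 ?j y2)
        + PsiK (dd3 h) * DK (map3 ?j y3)"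
      unfolding PsiK_def by (rule derivation_eval3[OF DK(1)])
    ultimately show ?thesis
      by (simp only: PsiK_def eval3_simps mult.commute)
  qed
  \<comment> \<open>\<open>E\<close> is the extended derivation written in the coordinates
    \<open>y1\<close>, \<open>y2\<close>, \<open>y3\<close>.\<close>
  define E where "E = (\<lambda>h. dd1 h * C3 (?j a) + dd2 h * cx ?fK + dd3 h * [:?gK:])"
  have E: "is_derivation E" unfolding E_def by (rule is_derivation_lin3)
  have DKE: "DK (PsiK h) = PsiK (E h)" for h
    unfolding DPsiK E_def by (simp only: mult.commute)
  have norank: False if "coord3 u v w" "E u = 0" "E v = 0" for u v w
  proof -
    have 0: "PsiK 0 = 0" unfolding PsiK_def by (rule eval3_simps(1))
    have "rank3 DK \<le> 1"
    proof (rule rank3_le_1[OF DK(1)])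
      show "coord3 (PsiK u) (PsiK v) (PsiK w)"
        unfolding PsiK_def by (rule coord3_eval3[OF that(1) coK])
      show "DK (PsiK u) = 0" "DK (PsiK v) = 0" unfolding DKE that 0 by (rule refl)+
    qed
    then show False using assms(6) DK_def by simp
  qed
  have a0: "a = 0"
  proof (rule ccontr)
    assume "a \<noteq> 0"
    then have "?j a \<noteq> 0" by (simp add: Zero_fract_def eq_fract)
    from rank_le_one_of_slice_x[OF chK this E, of ?fK ?gK] show False
      using norank by (auto simp: E_def simp del: mult_pCons_left mult_pCons_right)
  qed
  have f0: "f \<noteq> 0"
  proof
    assume "f = 0"
    then have "D y2 = 0" using Dy2 f[of y1 0 0] eval3_simps(1)[of y1 0 0] by simp
    moreover have "D y1 = 0" using Dy1 a0 by (simp add: hom_0[OF is_hom_C3])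
    ultimately have "rank3 D \<le> 1" using rank3_le_1[OF D co] by blast
    then show False using assms(5) by simp
  qed
  have Ea: "E h = cx ?fK * dd2 h + [:?gK:] * dd3 h" for h
  proof -
    have "C3 (?j a) = 0" unfolding a0 hom_0[OF j] by (rule hom_0[OF is_hom_C3])
    then show ?thesis unfolding E_def by (simp only: mult.commute mult_zero_left add_0_left)
  qed
  \<comment> \<open>\<open>X\<close>, \<open>Y\<close>, \<open>Z\<close> in terms of
    \<open>y1\<close>, \<open>y2\<close>, \<open>y3\<close>; the aim is that \<open>X'\<close>
    involves the first variable only.\<close>
  obtain X' Y' Z' where XYZ: "Psi X' = X" "Psi Y' = Y" "Psi Z' = Z" using ex by metis
  have coX: "coord3 X' Y' Z'"
  proof -
    have "\<exists>c. b = eval3 c X' Y' Z'" for b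
    proof -
      obtain c where c: "eval3 c X Y Z = Psi b" using coord3_ex[OF assms(3)] by blast
      have "Psi (eval3 c X' Y' Z') = eval3 c X Y Z"
        unfolding XYZ[symmetric] Psi_def by (rule eval3_eval3)
      then have "Psi b = Psi (eval3 c X' Y' Z')" unfolding c ..
      then show ?thesis using injD[OF inj] by blast
    qed
    then show ?thesis unfolding coord3_def by auto
  qed
  have PsiK_inj: "inj PsiK" unfolding PsiK_def by (rule coord3_inj[OF chK coK])
  have PsiK_map3: "PsiK (map3 ?j h) = map3 ?j (Psi h)" for h
    unfolding PsiK_def Psi_def by (rule map3_eval3[OF j, symmetric])
  have EX: "E (map3 ?j X') = 0"
  proof -
    have "PsiK (E (map3 ?j X')) = map3 ?j (D X)"
      unfolding DKE[symmetric] PsiK_map3 XYZ DK ..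
    also have "\<dots> = PsiK 0"
      unfolding assms(4) PsiK_def hom_0[OF j3] by (rule eval3_simps(1)[symmetric])
    finally show ?thesis using PsiK_inj by (metis injD)
  qed
  have "map3 ?j X' \<in> range cx"
  proof (rule ccontr)
    assume n: "map3 ?j X' \<notin> range cx"
    have "?fK \<noteq> 0"
    proof
      assume "?fK = 0"
      then have "?j (coeff f n) = ?j 0" for n
        using coeff_map_poly[of ?j f n] hom_0[OF j] by simp
      then have "coeff f n = 0" for n using inj_Fract by (metis injD)
      then show False using f0 by (simp add: poly_eq_iff)
    qed
    then obtain P s where "coord3 X1 P s" "E P = 0"
      using kernel_coordinate_or_rank_le_one[OF chK _ coord3_map3[OF j coX] _ n, of ?fK ?gK] EX
      unfolding Ea by blast
    moreover have "E X1 = 0" unfolding Ea by simp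
    ultimately show False using norank by blast
  qed
  then obtain p where p: "X' = cx p" using map3_in_range_cx[OF j inj_Fract] by blast
  \<comment> \<open>Inverting X = p(y1) through the coordinate system over \<open>A\<close> gives y1
    = q(X) with coefficients of \<open>q\<close> in \<open>A\<close>, not merely in its fraction
    field.\<close>
  obtain t where t: "eval3 t X' Y' Z' = X1" using coord3_ex[OF coX] by blast
  have "X1 = eval3 (cx p) t 0 0"
  proof (rule injD[OF coord3_inj[OF ch coX]])
    have "eval3 (eval3 (cx p) t 0 0) X' Y' Z' = eval3 (cx p) X1 (eval3 0 X' Y' Z') (eval3 0 X' Y' Z')"
      unfolding eval3_eval3 t ..
    also have "\<dots> = cx p" using eval3_const2[of p X1 _ _ X2 X3] by simp
    finally show "eval3 X1 X' Y' Z' = eval3 (eval3 (cx p) t 0 0) X' Y' Z'" by (simp add: p)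
  qed
  then obtain q where q: "t = cx q" using X1_eq_eval3_cx by blast
  have y1: "y1 = eval3 (cx q) X v w" for v w
  proof -
    have "y1 = Psi (eval3 t X' Y' Z')" unfolding t Psi_def by simp
    also have "\<dots> = eval3 (cx q) X Y Z"
      unfolding q XYZ[symmetric] Psi_def by (rule eval3_eval3)
    finally show ?thesis using eval3_const2 by metis
  qed
  show "triangulable_over_var D X"
    unfolding triangulable_over_var_def
  proof (intro exI conjI)
    show "range (\<lambda>f. eval3 f X y2 y3) = UNIV"
      using coord3_replace_first[OF co y1] unfolding coord3_def .
    have z: "eval3 0 u v w = 0" for u v w :: "'a poly poly poly" by (rule eval3_simps(1))
    show "D y2 = eval3 (eval3 F1 (cx q) 0 0) X 0 0"
      unfolding Dy2 eval3_eval3 y1[symmetric] z ..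
    show "D y3 = eval3 (eval3 F2 (cx q) X2 0) X y2 0"
      unfolding Dy3 eval3_eval3 y1[symmetric] z eval3_X2 ..
  qed
qed

end
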